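(* Let $\varphi:\mathbb R\to\mathbb R$, let $x_0\in\arg\inf_{x\in[-\infty,\infty]}\varphi(x)$ and assume $D^+\varphi(x_0)=D^-\varphi(x_0)=0$. Define $$h_u^v(x)=(v-x\vee u)^+\mathbf 1_{\{x>x_0\}}-(v\wedge x-u)^+\mathbf 1_{\{x\le x_0\}}\qquad(x,u,v\in\mathbb R).$$ Let $\mathscr N$ be an ideal of subsets of a set $\Omega$ and $X:\Omega\to\mathbb R$. The following properties are mutually equivalent: (i) $\varphi$ is convex and $\{u<X<v\}\in\mathscr N$ implies $D^-\varphi(v)\le D^+\varphi(u)$; (ii) there exists $(\mathscr R,\lambda)\in\mathscr M(\Omega)$ such that (a) $\mathscr N\subset\mathscr R$ and $\lambda(N)=0$ for all $N\in\mathscr N$, (b) $\lim_n\lambda^*(|X-x_0|<2^{-n})=0$, (c) $h_u^v(X)\in L^1(\lambda)$ for all $u,v\in\mathbb R$, and $$\varphi(v)=\varphi(u)+\int h_u^v(X)\,d\lambda\qquad(v\ge u);$$ (iii) there exists a countably additive $\nu\in fa(\mathscr B(\mathbb R))_+$ such that (a) $\nu(A)=0$ for every open $A\subset\mathbb R$ with $X^{-1}(A)\in\mathscr N$, (b) $\nu^*(\{x_0\})=0$, (c) $h_u^v\in L^1(\nu)$ for all $u,v\in\mathbb R$, and $$\varphi(v)=\varphi(u)+\int h_u^v\,d\nu\qquad(v\ge u).$$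
   Context: $D^+\varphi$ and $D^-\varphi$ are the right and left derivatives, when they exist; conventionally $D^+\varphi(\infty)=D^-\varphi(\infty)=\lim_{x\to\infty}D^+\varphi(x)$ and $D^+\varphi(-\infty)=D^-\varphi(-\infty)=\lim_{x\to-\infty}D^+\varphi(x)$. The point $x_0$ may be $\pm\infty$, where $\varphi(\pm\infty)$ is understood as the corresponding limit; when $x_0=\pm\infty$ the sets $\{|X-x_0|<2^{-n}\}$ and $\{x_0\}\cap\mathbb R$ are empty. An ideal of subsets is a non-empty family closed under subsets and finite unions. $\mathscr B(\mathbb R)$ is the Borel $\sigma$-algebra of $\mathbb R$. For a ring $\mathscr A$ of sets, $fa(\mathscr A)$ is the space of real-valued, finitely additive set functions on $\mathscr A$ and $fa(\mathscr A)_+$ its non-negative elements. Finitely additive integration. A measure structure on $\Omega$ is a pair $(\mathscr A,\lambda)$ with $\mathscr A$ a ring of subsets of $\Omega$ and $\lambda\in fa(\mathscr A)_+$; $\mathscr M(\Omega)$ is the collection of all of them. $\mathscr S(\mathscr A)$ is the linear span of the indicators of members of $\mathscr A$, with the obvious integral. For $E\subset\Omega$, $\lambda^*(E)=\inf\{\lambda(A):A\in\mathscr A, E\subset A\}$ (with $\inf\varnothing=\infty$). $X_n$ $\lambda$-converges to $X$ if $\lim_n\lambda^*(|X_n-X|>c)=0$ for every $c>0$. $X\in L^1(\lambda)$ if there is a sequence $X_n\in\mathscr S(\mathscr A)$ that $\lambda$-converges to $X$ and is Cauchy in the sense $\int|X_n-X_k|\,d\lambda\to0$ as $n,k\to\infty$;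 then $\int X\,d\lambda=\lim_n\int X_n\,d\lambda$. The same definitions apply to $\nu$, with $\mathbb R$ and $\mathscr B(\mathbb R)$ in place of $\Omega$ and $\mathscr A$.
   Formalization: In (iii), ν is a countably additive Borel measure that may take the value +∞ (integrated through its sets of finite measure), not a real-valued element of fa(B(R))_+; with finite ν, (i)⇒(iii) fails, e.g. for φ(x)=x², x_0=0, X=id, N={∅}. *)

theory Defs
  imports "HOL-Analysis.Analysis"
begin

section \<open>Functions on the extended line\<close>

text \<open>
  Values and one-sided derivatives at points of \<open>[-\<infinity>, \<infinity>]\<close> are rendered as relations, because they
  need not exist. At \<open>\<plusminus>\<infinity>\<close> both one-sided derivatives are by convention the limit of the right
  derivative, which then has to exist near \<open>\<plusminus>\<infinity>\<close>.
\<close>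

definition has_ext_value :: "(real \<Rightarrow> real) \<Rightarrow> ereal \<Rightarrow> ereal \<Rightarrow> bool" where
  "has_ext_value \<phi> x L \<longleftrightarrow>
     (case x of
        ereal r \<Rightarrow> L = ereal (\<phi> r)
      | PInfty \<Rightarrow> ((\<lambda>r. ereal (\<phi> r)) \<longlongrightarrow> L) at_top
      | MInfty \<Rightarrow> ((\<lambda>r. ereal (\<phi> r)) \<longlongrightarrow> L) at_bot)"

definition is_arg_inf :: "(real \<Rightarrow> real) \<Rightarrow> ereal \<Rightarrow> bool" where
  "is_arg_inf \<phi> x0 \<longleftrightarrow>
     (\<exists>L. has_ext_value \<phi> x0 L \<and> (\<forall>y M. has_ext_value \<phi> y M \<longrightarrow> L \<le> M))"

definition has_limit_right_deriv :: "(real \<Rightarrow> real) \<Rightarrow> real filter \<Rightarrow> real \<Rightarrow> bool" where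
  "has_limit_right_deriv \<phi> F D \<longleftrightarrow>
     (\<exists>g. (\<forall>\<^sub>F x in F. (\<phi> has_real_derivative g x) (at_right x)) \<and> (g \<longlongrightarrow> D) F)"

definition has_right_deriv :: "(real \<Rightarrow> real) \<Rightarrow> ereal \<Rightarrow> real \<Rightarrow> bool" where
  "has_right_deriv \<phi> x D \<longleftrightarrow>
     (case x of
        ereal r \<Rightarrow> (\<phi> has_real_derivative D) (at_right r)
      | PInfty \<Rightarrow> has_limit_right_deriv \<phi> at_top D
      | MInfty \<Rightarrow> has_limit_right_deriv \<phi> at_bot D)"

definition has_left_deriv :: "(real \<Rightarrow> real) \<Rightarrow> ereal \<Rightarrow> real \<Rightarrow> bool" where
  "has_left_deriv \<phi> x D \<longleftrightarrow>
     (case x of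
        ereal r \<Rightarrow> (\<phi> has_real_derivative D) (at_left r)
      | PInfty \<Rightarrow> has_limit_right_deriv \<phi> at_top D
      | MInfty \<Rightarrow> has_limit_right_deriv \<phi> at_bot D)"

definition hfun :: "ereal \<Rightarrow> real \<Rightarrow> real \<Rightarrow> real \<Rightarrow> real" where
  "hfun x0 u v x =
     max 0 (v - max x u) * of_bool (ereal x > x0) - max 0 (min v x - u) * of_bool (ereal x \<le> x0)"


section \<open>Ideals and finitely additive integration\<close>

definition set_ideal :: "'a set \<Rightarrow> 'a set set \<Rightarrow> bool" where
  "set_ideal \<Omega> N \<longleftrightarrow>
     N \<subseteq> Pow \<Omega> \<and> N \<noteq> {} \<and> (\<forall>A\<in>N. \<forall>B. B \<subseteq> A \<longrightarrow> B \<in> N) \<and> (\<forall>A\<in>N. \<forall>B\<in>N. A \<union> B \<in> N)"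

definition measure_structure :: "'a set \<Rightarrow> 'a set set \<Rightarrow> ('a set \<Rightarrow> real) \<Rightarrow> bool" where
  "measure_structure \<Omega> \<A> \<mu> \<longleftrightarrow>
     ring_of_sets \<Omega> \<A> \<and> additive \<A> \<mu> \<and> (\<forall>A\<in>\<A>. 0 \<le> \<mu> A)"

definition fa_simple :: "'a set set \<Rightarrow> ('a \<Rightarrow> real) set" where
  "fa_simple \<A> =
     {\<lambda>\<omega>. \<Sum>A\<in>F. c A * indicator A \<omega> | F c. finite F \<and> F \<subseteq> \<A>}"

text \<open>
  The integral of a simple function, written through its level sets; the level set of \<open>0\<close> is left
  out since it need not belong to the ring.
\<close>

definition fa_simple_integral :: "'a set \<Rightarrow> ('a set \<Rightarrow> real) \<Rightarrow> ('a \<Rightarrow> real) \<Rightarrow> real" where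
  "fa_simple_integral \<Omega> \<mu> f = (\<Sum>y\<in>f ` \<Omega> - {0}. y * \<mu> {\<omega>\<in>\<Omega>. f \<omega> = y})"

definition fa_outer :: "'a set set \<Rightarrow> ('a set \<Rightarrow> real) \<Rightarrow> 'a set \<Rightarrow> ennreal" where
  "fa_outer \<A> \<mu> E = (INF A\<in>{A\<in>\<A>. E \<subseteq> A}. ennreal (\<mu> A))"

definition fa_converges ::
  "'a set \<Rightarrow> 'a set set \<Rightarrow> ('a set \<Rightarrow> real) \<Rightarrow> (nat \<Rightarrow> 'a \<Rightarrow> real) \<Rightarrow> ('a \<Rightarrow> real) \<Rightarrow> bool" where
  "fa_converges \<Omega> \<A> \<mu> s f \<longleftrightarrow>
     (\<forall>c>0. (\<lambda>n. fa_outer \<A> \<mu> {\<omega>\<in>\<Omega>. \<bar>s n \<omega> - f \<omega>\<bar> > c}) \<longlonglongrightarrow> 0)"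

definition fa_defining_seq ::
  "'a set \<Rightarrow> 'a set set \<Rightarrow> ('a set \<Rightarrow> real) \<Rightarrow> (nat \<Rightarrow> 'a \<Rightarrow> real) \<Rightarrow> ('a \<Rightarrow> real) \<Rightarrow> bool" where
  "fa_defining_seq \<Omega> \<A> \<mu> s f \<longleftrightarrow>
     (\<forall>n. s n \<in> fa_simple \<A>) \<and> fa_converges \<Omega> \<A> \<mu> s f \<and>
     (\<forall>e>0. \<exists>n0. \<forall>n\<ge>n0. \<forall>k\<ge>n0. fa_simple_integral \<Omega> \<mu> (\<lambda>\<omega>. \<bar>s n \<omega> - s k \<omega>\<bar>) < e)"

definition fa_L1 :: "'a set \<Rightarrow> 'a set set \<Rightarrow> ('a set \<Rightarrow> real) \<Rightarrow> ('a \<Rightarrow> real) set" where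
  "fa_L1 \<Omega> \<A> \<mu> = {f. \<exists>s. fa_defining_seq \<Omega> \<A> \<mu> s f}"

definition fa_integral ::
  "'a set \<Rightarrow> 'a set set \<Rightarrow> ('a set \<Rightarrow> real) \<Rightarrow> ('a \<Rightarrow> real) \<Rightarrow> real" where
  "fa_integral \<Omega> \<A> \<mu> f =
     (THE I. \<exists>s. fa_defining_seq \<Omega> \<A> \<mu> s f \<and> (\<lambda>n. fa_simple_integral \<Omega> \<mu> (s n)) \<longlonglongrightarrow> I)"

text \<open>
  A countably additive Borel measure \<open>\<nu>\<close> on the line enters this theory as the pair
  \<open>(fmeasurable \<nu>, measure \<nu>)\<close>. It is not required to be finite: a finite \<open>\<nu>\<close> can only represent
  Lipschitz functions \<open>\<phi>\<close>, as \<open>\<bar>hfun x0 u v x\<bar> \<le> v - u\<close> for \<open>u \<le> v\<close>. Restricting to sets of finite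
  measure keeps simple functions integrable and does not alter the outer measure. If \<open>\<nu>\<close> is
  finite, \<open>fmeasurable \<nu>\<close> is the whole Borel \<open>\<sigma>\<close>-algebra.
\<close>

lemma measure_structure_fmeasurable: "measure_structure (space \<nu>) (fmeasurable \<nu>) (measure \<nu>)"
proof -
  have "additive (fmeasurable \<nu>) (measure \<nu>)"
    by (auto simp: additive_def fmeasurable_def measure_Union)
  then show ?thesis
    by (simp add: measure_structure_def fmeasurable.ring_of_sets_axioms)
qed

lemma fa_outer_fmeasurable:
  "fa_outer (fmeasurable \<nu>) (measure \<nu>) E = (INF A\<in>{A\<in>sets \<nu>. E \<subseteq> A}. emeasure \<nu> A)"
proof (rule antisym)
  show "fa_outer (fmeasurable \<nu>) (measure \<nu>) E \<le> (INF A\<in>{A\<in>sets \<nu>. E \<subseteq> A}. emeasure \<nu> A)"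
  proof (rule INF_greatest)
    fix A assume A: "A \<in> {A\<in>sets \<nu>. E \<subseteq> A}"
    show "fa_outer (fmeasurable \<nu>) (measure \<nu>) E \<le> emeasure \<nu> A"
    proof (cases "emeasure \<nu> A = \<infinity>")
      case False
      then have "A \<in> fmeasurable \<nu>"
        using A by (simp add: fmeasurable_def top.not_eq_extremum)
      then show ?thesis
        using A unfolding fa_outer_def
        by (intro INF_lower2[of A]) (auto simp: emeasure_eq_measure2)
    qed simp
  qed
  show "(INF A\<in>{A\<in>sets \<nu>. E \<subseteq> A}. emeasure \<nu> A) \<le> fa_outer (fmeasurable \<nu>) (measure \<nu>) E"
    unfolding fa_outer_def
    by (rule INF_mono) (auto simp: emeasure_eq_measure2[symmetric])
qed

end

theory Submission
  imports Defs
begin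

text \<open>
  For fixed \<open>x\<close>, \<open>hfun x0 u v x\<close> is the increment over \<open>[u, v]\<close> of the convex function of \<open>t\<close> that is
  \<open>(t - x)\<^sup>+\<close> or \<open>(x - t)\<^sup>+\<close>, according as \<open>x\<close> lies to the right of \<open>x0\<close> or not. Integrating convexity
  in \<open>x\<close> makes every representable \<open>\<phi>\<close> convex; the integrand is affine on \<open>[u, v]\<close> unless \<open>u < x < v\<close>, so \<open>\<phi>\<close>
  is affine on \<open>[u, v]\<close> if the measure of \<open>{u < X < v}\<close> vanishes. Conversely, the Stieltjes measure of the
  right derivative of a convex \<open>\<phi>\<close>, which vanishes at \<open>x0\<close>, represents \<open>\<phi>\<close> on the line; on \<open>\<Omega>\<close> one takes the
  sets that differ by a member of \<open>N\<close> from the preimage of a Borel set with null boundary, and gives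
  them the measure of that Borel set.
\<close>


section \<open>Finitely additive integration\<close>

text \<open>Properties (ii) and (iii) are never compared directly: each is matched with (i), and
  both are treated as one kind of representation, with the identity of the line in place of
  \<open>X\<close> for (iii). On \<open>\<Omega>\<close> there is no countable additivity, so
  integrals are computed by uniform approximation, and the way back to (i) rests on positivity of
  the integral modulo outer-null sets. The Stieltjes measure is infinite when the derivative is
  unbounded. The split of \<open>hfun\<close> at \<open>x0\<close> keeps the integrals finite: the
  points between \<open>x0\<close> and \<open>t\<close> have mass \<open>\<bar>rd t\<bar>\<close>,
  because the derivative vanishes at \<open>x0\<close>, or tends to 0 there if \<open>x0\<close> is
  infinite.\<close>

locale measure_struct = ring_of_sets \<Omega> R
  for \<Omega> :: "'a set" and R :: "'a set set" +
  fixes \<mu> :: "'a set \<Rightarrow> real"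
  assumes additive: "additive R \<mu>"
    and nonneg: "\<And>A. A \<in> R \<Longrightarrow> 0 \<le> \<mu> A"
begin

abbreviation "int_s \<equiv> fa_simple_integral \<Omega> \<mu>"

lemma mu_empty: "\<mu> {} = 0"
  using additive empty_sets by (fastforce simp: additive_def)

lemma mu_Un_disjoint: "A \<in> R \<Longrightarrow> B \<in> R \<Longrightarrow> A \<inter> B = {} \<Longrightarrow> \<mu> (A \<union> B) = \<mu> A + \<mu> B"
  using additive by (simp add: additive_def)

lemma mu_mono:
  assumes "A \<in> R" "B \<in> R" "A \<subseteq> B" shows "\<mu> A \<le> \<mu> B"
proof -
  have "\<mu> B = \<mu> A + \<mu> (B - A)"
    using mu_Un_disjoint[of A "B - A"] assms by (auto simp: Un_absorb1)
  then show ?thesis using nonneg[of "B - A"] assms by auto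
qed

lemma mu_Un_le:
  assumes "A \<in> R" "B \<in> R" shows "\<mu> (A \<union> B) \<le> \<mu> A + \<mu> B"
proof -
  have "\<mu> (A \<union> B) = \<mu> A + \<mu> (B - A)"
    using mu_Un_disjoint[of A "B - A"] assms by (auto simp: Un_Diff_cancel)
  then show ?thesis using mu_mono[of "B - A" B] assms by auto
qed

lemma mu_UN_disjoint:
  assumes "finite I" "\<And>i. i \<in> I \<Longrightarrow> A i \<in> R" "disjoint_family_on A I"
  shows "\<mu> (\<Union>i\<in>I. A i) = (\<Sum>i\<in>I. \<mu> (A i))"
  using assms
proof (induction I rule: finite_induct)
  case (insert i I)
  have "\<mu> (A i \<union> (\<Union>j\<in>I. A j)) = \<mu> (A i) + \<mu> (\<Union>j\<in>I. A j)"
    using insert by (intro mu_Un_disjoint) (auto simp: disjoint_family_on_def)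
  moreover have "disjoint_family_on A I"
    using insert.prems by (auto simp: disjoint_family_on_def)
  ultimately show ?case using insert by auto
qed (simp add: mu_empty)

section \<open>Outer measure and its subadditivity\<close>

lemma fa_outer_le: "A \<in> R \<Longrightarrow> E \<subseteq> A \<Longrightarrow> fa_outer R \<mu> E \<le> ennreal (\<mu> A)"
  unfolding fa_outer_def by (rule INF_lower2[of A]) auto

lemma fa_outer_eq: "A \<in> R \<Longrightarrow> fa_outer R \<mu> A = ennreal (\<mu> A)"
  by (intro antisym fa_outer_le order_refl)
     (auto simp: fa_outer_def intro!: INF_greatest ennreal_leI mu_mono)

lemma fa_outer_mono: "E \<subseteq> F \<Longrightarrow> fa_outer R \<mu> E \<le> fa_outer R \<mu> F"
  unfolding fa_outer_def by (rule INF_superset_mono) auto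

lemma fa_outer_empty: "fa_outer R \<mu> {} = 0"
  using fa_outer_eq[OF empty_sets] by (simp add: mu_empty)

lemma fa_outer_Un_le: "fa_outer R \<mu> (E \<union> F) \<le> fa_outer R \<mu> E + fa_outer R \<mu> F"
proof (rule ennreal_le_epsilon)
  fix e :: real
  assume fin: "fa_outer R \<mu> E + fa_outer R \<mu> F < top" and e: "0 < e"
  have approx: "\<exists>A\<in>R. G \<subseteq> A \<and> ennreal (\<mu> A) < fa_outer R \<mu> G + ennreal (e / 2)"
    if "fa_outer R \<mu> G < top" for G
  proof -
    define L where "L = fa_outer R \<mu> G"
    have "L < L + ennreal (e / 2)"
      using that e ennreal_add_left_cancel_less[of L 0 "ennreal (e / 2)"] by (simp add: L_def)
    then have "(INF A\<in>{A\<in>R. G \<subseteq> A}. ennreal (\<mu> A)) < L + ennreal (e / 2)"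
      by (simp add: L_def fa_outer_def[symmetric])
    then show ?thesis by (auto simp: INF_less_iff L_def)
  qed
  obtain A B where A: "A \<in> R" "E \<subseteq> A" "ennreal (\<mu> A) < fa_outer R \<mu> E + ennreal (e / 2)"
    and B: "B \<in> R" "F \<subseteq> B" "ennreal (\<mu> B) < fa_outer R \<mu> F + ennreal (e / 2)"
    using approx[of E] approx[of F] fin by auto
  have "fa_outer R \<mu> (E \<union> F) \<le> ennreal (\<mu> (A \<union> B))"
    using A B by (intro fa_outer_le) auto
  also have "\<dots> \<le> ennreal (\<mu> A) + ennreal (\<mu> B)"
    using A B mu_Un_le nonneg by (simp add: ennreal_plus[symmetric] ennreal_leI del: ennreal_plus)
  also have "\<dots> \<le> (fa_outer R \<mu> E + ennreal (e / 2)) + (fa_outer R \<mu> F + ennreal (e / 2))"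
    using A(3) B(3) by (intro add_mono) auto
  also have "\<dots> = fa_outer R \<mu> E + fa_outer R \<mu> F + (ennreal (e / 2) + ennreal (e / 2))"
    by (simp add: algebra_simps)
  also have "ennreal (e / 2) + ennreal (e / 2) = ennreal e"
    using e by (simp add: ennreal_plus[symmetric] del: ennreal_plus)
  finally show "fa_outer R \<mu> (E \<union> F) \<le> fa_outer R \<mu> E + fa_outer R \<mu> F + ennreal e" .
qed


subsection \<open>Simple functions\<close>

text \<open>
  Simplicity is extended to maps into any pointed type, the level set of the distinguished point
  \<open>z\<close> being exempt from measurability. In this form it is stable under pairing and composition, and
  all rules for the integral follow from the change of variables \<open>int_s_comp\<close>.
\<close>

definition simple_map :: "'b \<Rightarrow> ('a \<Rightarrow> 'b) \<Rightarrow> bool" where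
  "simple_map z p \<longleftrightarrow> finite (range p) \<and> (\<forall>y. y \<noteq> z \<longrightarrow> p -` {y} \<in> R)"

text \<open>Level sets away from \<open>z\<close> lie in the ring, hence inside
  \<open>\<Omega>\<close>. Apart from \<open>z\<close>, the range of \<open>p\<close> is therefore
  its range on \<open>\<Omega>\<close>, the index set of \<open>fa_simple_integral\<close>.\<close>

lemma simple_map_outside:
  assumes "simple_map z p" "\<omega> \<notin> \<Omega>" shows "p \<omega> = z"
proof (rule ccontr)
  assume "p \<omega> \<noteq> z"
  then have "p -` {p \<omega>} \<subseteq> \<Omega>"
    using assms(1) sets_into_space unfolding simple_map_def by blast
  then show False using assms(2) by auto
qed

lemma simple_map_vimage:
  assumes "simple_map z p" "z \<notin> Y" shows "p -` Y \<in> R"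
proof -
  have "p -` Y = (\<Union>y\<in>range p \<inter> Y. p -` {y})" by auto
  also have "\<dots> \<in> R"
    using assms by (intro finite_UN) (auto simp: simple_map_def)
  finally show ?thesis .
qed

lemma simple_map_comp:
  assumes "simple_map z p" shows "simple_map (F z) (\<lambda>\<omega>. F (p \<omega>))"
  unfolding simple_map_def
proof (intro conjI allI impI)
  show "finite (range (\<lambda>\<omega>. F (p \<omega>)))"
    using assms by (simp add: simple_map_def image_image[symmetric, of F p])
  fix y assume "y \<noteq> F z"
  then have "p -` {x. F x = y} \<in> R"
    using assms by (intro simple_map_vimage) auto
  then show "(\<lambda>\<omega>. F (p \<omega>)) -` {y} \<in> R" by (simp add: vimage_def)
qed

lemma simple_map_Pair:
  assumes p: "simple_map a p" and q: "simple_map b q"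
  shows "simple_map (a, b) (\<lambda>\<omega>. (p \<omega>, q \<omega>))"
  unfolding simple_map_def
proof (intro conjI allI impI)
  have "range (\<lambda>\<omega>. (p \<omega>, q \<omega>)) \<subseteq> range p \<times> range q" by auto
  then show "finite (range (\<lambda>\<omega>. (p \<omega>, q \<omega>)))"
    using p q by (simp add: simple_map_def finite_subset)
  fix y assume y: "y \<noteq> (a, b)"
  have split: "(\<lambda>\<omega>. (p \<omega>, q \<omega>)) -` {y} = p -` {fst y} \<inter> q -` {snd y}"
    by (cases y) auto
  show "(\<lambda>\<omega>. (p \<omega>, q \<omega>)) -` {y} \<in> R"
  proof (cases "fst y = a")
    case True
    \<comment> \<open>The level set of \<open>a\<close> may lie outside the ring; intersecting with
      it is rewritten as subtracting the preimage of the complement of \<open>{a}\<close>, which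
      does lie in the ring.\<close>
    then have "p -` {fst y} \<inter> q -` {snd y} = q -` {snd y} - p -` (- {a})" by auto
    moreover have "q -` {snd y} \<in> R" "p -` (- {a}) \<in> R"
      using True y by (auto intro!: simple_map_vimage[OF p] simple_map_vimage[OF q])
    ultimately show ?thesis using split by auto
  next
    case pa: False
    then have p_in: "p -` {fst y} \<in> R" by (intro simple_map_vimage[OF p]) auto
    show ?thesis
    proof (cases "snd y = b")
      case True
      then have "p -` {fst y} \<inter> q -` {snd y} = p -` {fst y} - q -` (- {b})" by auto
      then show ?thesis using split p_in simple_map_vimage[OF q, of "- {b}"] by auto
    next
      case False
      then show ?thesis using split p_in simple_map_vimage[OF q, of "{snd y}"] by auto
    qed
  qed
qed

lemma simple_map_mem: "A \<in> R \<Longrightarrow> simple_map False (\<lambda>\<omega>. \<omega> \<in> A)"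
  by (auto simp: simple_map_def vimage_def)

lemma simple_map_add:
  fixes f g :: "'a \<Rightarrow> real"
  shows "simple_map 0 f \<Longrightarrow> simple_map 0 g \<Longrightarrow> simple_map 0 (\<lambda>\<omega>. f \<omega> + g \<omega>)"
  using simple_map_comp[OF simple_map_Pair[of 0 f 0 g], of "\<lambda>x. fst x + snd x"] by simp

lemma simple_map_indicator: "A \<in> R \<Longrightarrow> simple_map 0 (\<lambda>\<omega>. c * indicator A \<omega> :: real)"
  using simple_map_comp[OF simple_map_mem[of A], of "\<lambda>x. c * of_bool x"]
  by (simp add: indicator_def of_bool_def)

lemma fa_simple_iff: "f \<in> fa_simple R \<longleftrightarrow> simple_map 0 f"
proof
  assume "f \<in> fa_simple R"
  then obtain F c where F: "finite F" "F \<subseteq> R" and f: "f = (\<lambda>\<omega>. \<Sum>A\<in>F. c A * indicator A \<omega>)"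
    by (auto simp: fa_simple_def)
  have "simple_map 0 (\<lambda>\<omega>. \<Sum>A\<in>F. c A * indicator A \<omega> :: real)" using F
  proof (induction F rule: finite_induct)
    case empty
    show ?case using simple_map_indicator[OF empty_sets, of 0] by simp
  next
    case (insert A F)
    then have "simple_map 0 (\<lambda>\<omega>. c A * indicator A \<omega> + (\<Sum>A\<in>F. c A * indicator A \<omega>))"
      by (intro simple_map_add simple_map_indicator) auto
    then show ?case by (simp only: sum.insert[OF insert.hyps(1,2)])
  qed
  then show "simple_map 0 f" by (simp add: f)
next
  assume f: "simple_map 0 f"
  \<comment> \<open>The sum in \<open>fa_simple\<close> is indexed by sets, so the coefficient of a
    level set is recovered by evaluating \<open>f\<close> at any of its points.\<close>
  define c where "c A = f (SOME \<omega>. \<omega> \<in> A)" for A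
  define F where "F = (\<lambda>y. f -` {y}) ` (range f - {0})"
  have inj: "inj_on (\<lambda>y. f -` {y}) (range f - {0})"
    by (auto simp: inj_on_def)
  have c: "c (f -` {y}) = y" if y: "y \<in> range f" for y
  proof -
    have "(SOME \<omega>. \<omega> \<in> f -` {y}) \<in> f -` {y}"
      using y by (auto intro: someI)
    then show ?thesis by (simp add: c_def)
  qed
  have "f \<omega> = (\<Sum>A\<in>F. c A * indicator A \<omega>)" for \<omega>
  proof -
    have "(\<Sum>A\<in>F. c A * indicator A \<omega>) = (\<Sum>y\<in>range f - {0}. y * indicator (f -` {y}) \<omega>)"
      unfolding F_def by (subst sum.reindex[OF inj]) (auto simp: c intro!: sum.cong)
    also have "\<dots> = (\<Sum>y\<in>range f - {0}. if y = f \<omega> then y else 0)"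
      by (intro sum.cong) (auto simp: indicator_def)
    also have "\<dots> = f \<omega>" using f by (simp add: simple_map_def)
    finally show ?thesis by simp
  qed
  moreover have "finite F" "F \<subseteq> R"
    using f by (auto simp: F_def simple_map_def)
  ultimately show "f \<in> fa_simple R" unfolding fa_simple_def by blast
qed

text \<open>Each nonzero level set of the composition is a finite disjoint union of level sets of
  \<open>p\<close>; additivity splits its measure and the sum is regrouped. Since
  \<open>F z = 0\<close>, the exempt level set never enters.\<close>

lemma int_s_comp:
  assumes p: "simple_map z p" and F: "F z = 0"
  shows "int_s (\<lambda>\<omega>. F (p \<omega>)) = (\<Sum>x\<in>range p - {z}. F x * \<mu> (p -` {x}))"
proof -
  let ?f = "\<lambda>\<omega>. F (p \<omega>)"
  have f: "simple_map 0 ?f" using simple_map_comp[OF p, of F] F by simp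
  have fin: "finite (range p)" using p by (simp add: simple_map_def)
  have range: "?f ` \<Omega> - {0} = range ?f - {0}"
    using simple_map_outside[OF f] by fastforce
  have level: "{\<omega>\<in>\<Omega>. ?f \<omega> = y} = (\<Union>x\<in>{x\<in>range p - {z}. F x = y}. p -` {x})" if "y \<noteq> 0" for y
    using simple_map_outside[OF f] that F by auto
  have "int_s ?f = (\<Sum>y\<in>range ?f - {0}. y * (\<Sum>x\<in>{x\<in>range p - {z}. F x = y}. \<mu> (p -` {x})))"
    unfolding fa_simple_integral_def range
  proof (rule sum.cong[OF refl])
    fix y assume y: "y \<in> range ?f - {0}"
    have "\<mu> (\<Union>x\<in>{x\<in>range p - {z}. F x = y}. p -` {x})
        = (\<Sum>x\<in>{x\<in>range p - {z}. F x = y}. \<mu> (p -` {x}))"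
      using fin p by (intro mu_UN_disjoint) (auto simp: disjoint_family_on_def simple_map_def)
    then show "y * \<mu> {\<omega>\<in>\<Omega>. ?f \<omega> = y} = y * (\<Sum>x\<in>{x\<in>range p - {z}. F x = y}. \<mu> (p -` {x}))"
      using y level[of y] by simp
  qed
  also have "\<dots> = (\<Sum>y\<in>range ?f - {0}. \<Sum>x\<in>{x\<in>range p - {z}. F x = y}. F x * \<mu> (p -` {x}))"
    by (simp add: sum_distrib_left)
  also have "\<dots> = (\<Sum>x\<in>{x\<in>range p - {z}. F x \<noteq> 0}. F x * \<mu> (p -` {x}))"
  proof -
    have "(\<Sum>x\<in>{x\<in>range p - {z}. F x \<noteq> 0}. F x * \<mu> (p -` {x})) =
      (\<Sum>y\<in>range ?f - {0}. \<Sum>x\<in>{x\<in>{x\<in>range p - {z}. F x \<noteq> 0}. F x = y}. F x * \<mu> (p -` {x}))"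
      using fin f by (intro sum.group[symmetric]) (auto simp: simple_map_def)
    also have "\<dots> = (\<Sum>y\<in>range ?f - {0}. \<Sum>x\<in>{x\<in>range p - {z}. F x = y}. F x * \<mu> (p -` {x}))"
      by (intro sum.cong refl) auto
    finally show ?thesis by simp
  qed
  also have "\<dots> = (\<Sum>x\<in>range p - {z}. F x * \<mu> (p -` {x}))"
    using fin by (intro sum.mono_neutral_left) auto
  finally show ?thesis .
qed

lemma int_s_indicator: "A \<in> R \<Longrightarrow> int_s (\<lambda>\<omega>. c * indicator A \<omega>) = c * \<mu> A"
proof -
  assume A: "A \<in> R"
  have "int_s (\<lambda>\<omega>. c * of_bool (\<omega> \<in> A))
      = (\<Sum>x\<in>range (\<lambda>\<omega>. \<omega> \<in> A) - {False}. c * of_bool x * \<mu> ((\<lambda>\<omega>. \<omega> \<in> A) -` {x}))"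
    by (rule int_s_comp[OF simple_map_mem[OF A], of "\<lambda>x. c * of_bool x"]) simp
  \<comment> \<open>\<open>True\<close> is missing from the range when \<open>A\<close> is empty;
    the summand added then is a multiple of \<open>\<mu> {} = 0\<close>.\<close>
  also have "\<dots> = (\<Sum>x\<in>{True}. c * of_bool x * \<mu> ((\<lambda>\<omega>. \<omega> \<in> A) -` {x}))"
  proof (rule sum.mono_neutral_left)
    show "\<forall>x\<in>{True} - (range (\<lambda>\<omega>. \<omega> \<in> A) - {False}). c * of_bool x * \<mu> ((\<lambda>\<omega>. \<omega> \<in> A) -` {x}) = 0"
    proof
      fix x assume "x \<in> {True} - (range (\<lambda>\<omega>. \<omega> \<in> A) - {False})"
      then have "(\<lambda>\<omega>. \<omega> \<in> A) -` {x} = {}" by auto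
      then show "c * of_bool x * \<mu> ((\<lambda>\<omega>. \<omega> \<in> A) -` {x}) = 0" by (simp add: mu_empty)
    qed
  qed auto
  finally show ?thesis by (simp add: indicator_def of_bool_def vimage_def)
qed

context
  fixes f g :: "'a \<Rightarrow> real"
  assumes f: "simple_map 0 f" and g: "simple_map 0 g"
begin

lemma simple_map_linear: "simple_map 0 (\<lambda>\<omega>. a * f \<omega> + b * g \<omega>)"
  using simple_map_comp[OF simple_map_Pair[OF f g], of "\<lambda>x. a * fst x + b * snd x"] by simp

text \<open>The level sets of the pair are a common refinement of those of \<open>f\<close> and
  \<open>g\<close>, so linearity and monotonicity become termwise statements about sums over one
  index set.\<close>

lemma int_s_pair:
  assumes "F (0, 0) = 0"
  shows "int_s (\<lambda>\<omega>. F (f \<omega>, g \<omega>)) =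
    (\<Sum>x\<in>range (\<lambda>\<omega>. (f \<omega>, g \<omega>)) - {(0, 0)}. F x * \<mu> ((\<lambda>\<omega>. (f \<omega>, g \<omega>)) -` {x}))"
  by (rule int_s_comp[where F = F, OF simple_map_Pair[OF f g] assms])

lemma int_s_linear: "int_s (\<lambda>\<omega>. a * f \<omega> + b * g \<omega>) = a * int_s f + b * int_s g"
  using int_s_pair[of "\<lambda>x. a * fst x + b * snd x"] int_s_pair[of fst] int_s_pair[of snd]
  by (simp add: sum.distrib sum_distrib_left distrib_right mult.assoc)

lemma int_s_mono:
  assumes "\<And>\<omega>. f \<omega> \<le> g \<omega>" shows "int_s f \<le> int_s g"
proof -
  have "int_s f = (\<Sum>x\<in>range (\<lambda>\<omega>. (f \<omega>, g \<omega>)) - {(0, 0)}. fst x * \<mu> ((\<lambda>\<omega>. (f \<omega>, g \<omega>)) -` {x}))"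
    using int_s_pair[of fst] by simp
  also have "\<dots> \<le> (\<Sum>x\<in>range (\<lambda>\<omega>. (f \<omega>, g \<omega>)) - {(0, 0)}. snd x * \<mu> ((\<lambda>\<omega>. (f \<omega>, g \<omega>)) -` {x}))"
  proof (rule sum_mono)
    fix x assume x: "x \<in> range (\<lambda>\<omega>. (f \<omega>, g \<omega>)) - {(0, 0)}"
    then have "(\<lambda>\<omega>. (f \<omega>, g \<omega>)) -` {x} \<in> R"
      by (intro simple_map_vimage[OF simple_map_Pair[OF f g]]) auto
    then show "fst x * \<mu> ((\<lambda>\<omega>. (f \<omega>, g \<omega>)) -` {x}) \<le> snd x * \<mu> ((\<lambda>\<omega>. (f \<omega>, g \<omega>)) -` {x})"
      using x assms nonneg by (intro mult_right_mono) auto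
  qed
  also have "\<dots> = int_s g" using int_s_pair[of snd] by simp
  finally show ?thesis .
qed

end

lemma simple_map_abs_diff:
  fixes f g :: "'a \<Rightarrow> real"
  assumes "simple_map 0 f" "simple_map 0 g" shows "simple_map 0 (\<lambda>\<omega>. \<bar>f \<omega> - g \<omega>\<bar>)"
  using simple_map_comp[OF simple_map_Pair[OF assms], of "\<lambda>x. \<bar>fst x - snd x\<bar>"] by simp

lemma int_s_nonneg:
  assumes "simple_map 0 f" "\<And>\<omega>. 0 \<le> f \<omega>" shows "0 \<le> int_s f"
  using int_s_mono[OF simple_map_indicator[OF empty_sets, of 0] assms(1)] assms(2)
    int_s_indicator[OF empty_sets, of 0] by simp

lemma int_s_le_add:
  assumes "simple_map 0 f" "simple_map 0 g" "simple_map 0 h" "\<And>\<omega>. f \<omega> \<le> a * g \<omega> + b * h \<omega>"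
  shows "int_s f \<le> a * int_s g + b * int_s h"
  using int_s_mono[OF assms(1) simple_map_linear[OF assms(2,3)]] assms(4) int_s_linear[OF assms(2,3)]
  by simp

lemma abs_int_s_diff_le:
  assumes "simple_map 0 f" "simple_map 0 g"
  shows "\<bar>int_s f - int_s g\<bar> \<le> int_s (\<lambda>\<omega>. \<bar>f \<omega> - g \<omega>\<bar>)"
proof -
  have "int_s f \<le> 1 * int_s g + 1 * int_s (\<lambda>\<omega>. \<bar>f \<omega> - g \<omega>\<bar>)"
    by (intro int_s_le_add simple_map_abs_diff assms) auto
  moreover have "int_s g \<le> 1 * int_s f + 1 * int_s (\<lambda>\<omega>. \<bar>f \<omega> - g \<omega>\<bar>)"
    by (intro int_s_le_add simple_map_abs_diff assms) auto
  ultimately show ?thesis by auto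
qed

end

lemma measure_struct_iff: "measure_struct \<Omega> R \<mu> \<longleftrightarrow> measure_structure \<Omega> R \<mu>"
  by (auto simp: measure_structure_def measure_struct_def measure_struct_axioms_def)

context measure_struct
begin

subsection \<open>The integral\<close>

text \<open>
  A fixed \<open>d n0\<close> close in mean to all later \<open>d n\<close> is bounded and lives on a set of \<open>R\<close>; so \<open>d n\<close>
  is, up to a function of small integral, at most \<open>c\<close> on that set, except on \<open>{d n > c}\<close>, where it
  is bounded.
\<close>

lemma int_s_tendsto_0:
  assumes d: "\<And>n. simple_map 0 (d n)" and d0: "\<And>n \<omega>. 0 \<le> d n \<omega>"
    and conv: "\<And>c. 0 < c \<Longrightarrow> (\<lambda>n. fa_outer R \<mu> {\<omega>\<in>\<Omega>. c < d n \<omega>}) \<longlonglongrightarrow> 0"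
    and cauchy: "\<And>e. 0 < e \<Longrightarrow> \<exists>n0. \<forall>n\<ge>n0. \<forall>k\<ge>n0. int_s (\<lambda>\<omega>. \<bar>d n \<omega> - d k \<omega>\<bar>) < e"
  shows "(\<lambda>n. int_s (d n)) \<longlonglongrightarrow> 0"
proof (rule LIMSEQ_I)
  fix e :: real assume e: "0 < e"
  obtain n0 where n0: "\<And>n k. n0 \<le> n \<Longrightarrow> n0 \<le> k \<Longrightarrow> int_s (\<lambda>\<omega>. \<bar>d n \<omega> - d k \<omega>\<bar>) < e / 3"
    using cauchy[of "e / 3"] e by auto
  define A where "A = d n0 -` (- {0})"
  have A: "A \<in> R" unfolding A_def by (rule simple_map_vimage[OF d]) simp
  obtain M where M: "0 < M" "\<And>\<omega>. d n0 \<omega> \<le> M"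
  proof
    have "finite (range (d n0))" using d[of n0] by (simp add: simple_map_def)
    then show "d n0 \<omega> \<le> Max (range (d n0)) + 1" for \<omega>
      by (intro order_trans[OF Max_ge[of "range (d n0)" "d n0 \<omega>"]]) auto
    have "d n0 undefined \<le> Max (range (d n0))"
      using \<open>finite (range (d n0))\<close> by (intro Max_ge) auto
    then show "0 < Max (range (d n0)) + 1"
      using d0[of n0 undefined] by simp
  qed
  \<comment> \<open>The \<open>+ 1\<close> keeps the denominator positive when
    \<open>\<mu> A = 0\<close>.\<close>
  define c where "c = e / (3 * (\<mu> A + 1))"
  have c: "0 < c" "c * \<mu> A < e / 3"
    using e nonneg[OF A] by (auto simp: c_def field_simps)
  have "\<forall>\<^sub>F n in sequentially. fa_outer R \<mu> {\<omega>\<in>\<Omega>. c < d n \<omega>} < ennreal (e / (3 * M))"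
    using e M by (intro order_tendstoD(2)[OF conv[OF c(1)]]) simp
  then obtain n1 where n1: "\<And>n. n1 \<le> n \<Longrightarrow> fa_outer R \<mu> {\<omega>\<in>\<Omega>. c < d n \<omega>} < ennreal (e / (3 * M))"
    by (auto simp: eventually_sequentially)
  have "norm (int_s (d n) - 0) < e" if n: "max n0 n1 \<le> n" for n
  proof -
    define B where "B = d n -` {c<..}"
    have B: "B \<in> R" unfolding B_def by (rule simple_map_vimage[OF d]) (use c in auto)
    have "B = {\<omega>\<in>\<Omega>. c < d n \<omega>}"
      using sets_into_space[OF B] by (auto simp: B_def)
    then have "ennreal (\<mu> B) < ennreal (e / (3 * M))"
      using n1[of n] n fa_outer_eq[OF B] by simp
    then have "\<mu> B < e / (3 * M)" using nonneg[OF B] by (simp add: ennreal_less_iff)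
    then have MB: "M * \<mu> B < e / 3" using M by (simp add: field_simps)
    have ind: "simple_map 0 (\<lambda>\<omega>. c * indicator A \<omega> :: real)" "simple_map 0 (\<lambda>\<omega>. M * indicator B \<omega> :: real)"
      by (intro simple_map_indicator A B)+
    have "int_s (d n) \<le> 1 * int_s (\<lambda>\<omega>. \<bar>d n \<omega> - d n0 \<omega>\<bar>) +
        1 * int_s (\<lambda>\<omega>. 1 * (c * indicator A \<omega>) + 1 * (M * indicator B \<omega>))"
    proof (intro int_s_le_add d simple_map_abs_diff simple_map_linear[OF ind])
      fix \<omega>
      show "d n \<omega> \<le> 1 * \<bar>d n \<omega> - d n0 \<omega>\<bar> +
          1 * (1 * (c * indicator A \<omega>) + 1 * (M * indicator B \<omega>))"
        using M(1) M(2)[of \<omega>] c(1) d0[of n0 \<omega>] by (auto simp: indicator_def A_def B_def)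
    qed
    also have "\<dots> = int_s (\<lambda>\<omega>. \<bar>d n \<omega> - d n0 \<omega>\<bar>) + (c * \<mu> A + M * \<mu> B)"
      by (subst int_s_linear[OF ind]) (simp add: int_s_indicator A B)
    also have "\<dots> < e" using n0[of n n0] n c(2) MB by simp
    finally show ?thesis using int_s_nonneg[OF d d0, of n] by simp
  qed
  then show "\<exists>no. \<forall>n\<ge>no. norm (int_s (d n) - 0) < e" by blast
qed

abbreviation "defining_seq \<equiv> fa_defining_seq \<Omega> R \<mu>"

lemma defining_seq_simple: "defining_seq s f \<Longrightarrow> simple_map 0 (s n)"
  by (simp add: fa_defining_seq_def fa_simple_iff)

lemma defining_seq_conv:
  "defining_seq s f \<Longrightarrow> 0 < c \<Longrightarrow> (\<lambda>n. fa_outer R \<mu> {\<omega>\<in>\<Omega>. c < \<bar>s n \<omega> - f \<omega>\<bar>}) \<longlonglongrightarrow> 0"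
  by (simp add: fa_defining_seq_def fa_converges_def)

lemma defining_seq_cauchy:
  "defining_seq s f \<Longrightarrow> 0 < e \<Longrightarrow> \<exists>n0. \<forall>n\<ge>n0. \<forall>k\<ge>n0. int_s (\<lambda>\<omega>. \<bar>s n \<omega> - s k \<omega>\<bar>) < e"
  by (simp add: fa_defining_seq_def)

lemma fa_outer_tendsto_0_subset:
  assumes "(\<lambda>n. fa_outer R \<mu> (E n)) \<longlonglongrightarrow> 0" "(\<lambda>n. fa_outer R \<mu> (F n)) \<longlonglongrightarrow> 0"
    and "\<And>n. G n \<subseteq> E n \<union> F n"
  shows "(\<lambda>n. fa_outer R \<mu> (G n)) \<longlonglongrightarrow> 0"
proof (rule tendsto_sandwich[OF _ _ tendsto_const])
  show "(\<lambda>n. fa_outer R \<mu> (E n) + fa_outer R \<mu> (F n)) \<longlonglongrightarrow> 0"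
    using tendsto_add[OF assms(1,2)] by simp
  show "\<forall>\<^sub>F n in sequentially. fa_outer R \<mu> (G n) \<le> fa_outer R \<mu> (E n) + fa_outer R \<mu> (F n)"
    using fa_outer_mono[OF assms(3)] fa_outer_Un_le order_trans by (intro always_eventually allI) blast
qed simp

lemma defining_seq_linear:
  assumes s: "defining_seq s f" and t: "defining_seq t g"
  shows "defining_seq (\<lambda>n \<omega>. a * s n \<omega> + b * t n \<omega>) (\<lambda>\<omega>. a * f \<omega> + b * g \<omega>)"
  unfolding fa_defining_seq_def fa_converges_def
proof (intro conjI allI impI)
  note ss = defining_seq_simple[OF s] and ts = defining_seq_simple[OF t]
  show "(\<lambda>\<omega>. a * s n \<omega> + b * t n \<omega>) \<in> fa_simple R" for n
    unfolding fa_simple_iff by (intro simple_map_linear ss ts)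
  \<comment> \<open>The factors \<open>\<bar>a\<bar> + 1\<close> and
    \<open>\<bar>b\<bar> + 1\<close> stay positive when a coefficient vanishes, so the tolerances
    below can be divided by them.\<close>
  have split: "\<bar>a * p + b * q\<bar> \<le> (\<bar>a\<bar> + 1) * \<bar>p\<bar> + (\<bar>b\<bar> + 1) * \<bar>q\<bar>" for p q
  proof -
    have "\<bar>a * p + b * q\<bar> \<le> \<bar>a\<bar> * \<bar>p\<bar> + \<bar>b\<bar> * \<bar>q\<bar>"
      using abs_triangle_ineq[of "a * p" "b * q"] by (simp add: abs_mult)
    then show ?thesis
      unfolding distrib_right mult_1 using abs_ge_zero[of p] abs_ge_zero[of q] by linarith
  qed
  {
    fix c :: real assume c: "0 < c"
    show "(\<lambda>n. fa_outer R \<mu> {\<omega>\<in>\<Omega>. c < \<bar>a * s n \<omega> + b * t n \<omega> - (a * f \<omega> + b * g \<omega>)\<bar>}) \<longlonglongrightarrow> 0"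
    proof (rule fa_outer_tendsto_0_subset)
      show "(\<lambda>n. fa_outer R \<mu> {\<omega>\<in>\<Omega>. c / (2 * (\<bar>a\<bar> + 1)) < \<bar>s n \<omega> - f \<omega>\<bar>}) \<longlonglongrightarrow> 0"
        "(\<lambda>n. fa_outer R \<mu> {\<omega>\<in>\<Omega>. c / (2 * (\<bar>b\<bar> + 1)) < \<bar>t n \<omega> - g \<omega>\<bar>}) \<longlonglongrightarrow> 0"
        using c by (intro defining_seq_conv[OF s] defining_seq_conv[OF t]; simp)+
      fix n
      show "{\<omega>\<in>\<Omega>. c < \<bar>a * s n \<omega> + b * t n \<omega> - (a * f \<omega> + b * g \<omega>)\<bar>} \<subseteq>
        {\<omega>\<in>\<Omega>. c / (2 * (\<bar>a\<bar> + 1)) < \<bar>s n \<omega> - f \<omega>\<bar>} \<union>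
        {\<omega>\<in>\<Omega>. c / (2 * (\<bar>b\<bar> + 1)) < \<bar>t n \<omega> - g \<omega>\<bar>}"
      proof (rule ccontr)
        assume "\<not> ?thesis"
        then obtain \<omega> where
          far: "c < \<bar>a * s n \<omega> + b * t n \<omega> - (a * f \<omega> + b * g \<omega>)\<bar>" and
          near: "\<bar>s n \<omega> - f \<omega>\<bar> \<le> c / (2 * (\<bar>a\<bar> + 1))" "\<bar>t n \<omega> - g \<omega>\<bar> \<le> c / (2 * (\<bar>b\<bar> + 1))"
          by fastforce
        have "a * s n \<omega> + b * t n \<omega> - (a * f \<omega> + b * g \<omega>) = a * (s n \<omega> - f \<omega>) + b * (t n \<omega> - g \<omega>)"
          by (simp add: algebra_simps)
        moreover have "(\<bar>a\<bar> + 1) * \<bar>s n \<omega> - f \<omega>\<bar> \<le> c / 2" "(\<bar>b\<bar> + 1) * \<bar>t n \<omega> - g \<omega>\<bar> \<le> c / 2"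
          using near by (simp_all add: field_simps)
        ultimately show False using far split[of "s n \<omega> - f \<omega>" "t n \<omega> - g \<omega>"] by simp
      qed
    qed
  next
    fix e :: real assume e: "0 < e"
    obtain n1 where n1: "\<And>n k. n1 \<le> n \<Longrightarrow> n1 \<le> k \<Longrightarrow>
        int_s (\<lambda>\<omega>. \<bar>s n \<omega> - s k \<omega>\<bar>) < e / (2 * (\<bar>a\<bar> + 1))"
      using defining_seq_cauchy[OF s, of "e / (2 * (\<bar>a\<bar> + 1))"] e by auto
    obtain n2 where n2: "\<And>n k. n2 \<le> n \<Longrightarrow> n2 \<le> k \<Longrightarrow>
        int_s (\<lambda>\<omega>. \<bar>t n \<omega> - t k \<omega>\<bar>) < e / (2 * (\<bar>b\<bar> + 1))"
      using defining_seq_cauchy[OF t, of "e / (2 * (\<bar>b\<bar> + 1))"] e by auto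
    have "int_s (\<lambda>\<omega>. \<bar>a * s n \<omega> + b * t n \<omega> - (a * s k \<omega> + b * t k \<omega>)\<bar>) < e"
      if nk: "max n1 n2 \<le> n" "max n1 n2 \<le> k" for n k
    proof -
      have "int_s (\<lambda>\<omega>. \<bar>a * s n \<omega> + b * t n \<omega> - (a * s k \<omega> + b * t k \<omega>)\<bar>) \<le>
        (\<bar>a\<bar> + 1) * int_s (\<lambda>\<omega>. \<bar>s n \<omega> - s k \<omega>\<bar>) + (\<bar>b\<bar> + 1) * int_s (\<lambda>\<omega>. \<bar>t n \<omega> - t k \<omega>\<bar>)"
      proof (intro int_s_le_add simple_map_abs_diff simple_map_linear ss ts)
        fix \<omega>
        have "a * s n \<omega> + b * t n \<omega> - (a * s k \<omega> + b * t k \<omega>) = a * (s n \<omega> - s k \<omega>) + b * (t n \<omega> - t k \<omega>)"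
          by (simp add: algebra_simps)
        then show "\<bar>a * s n \<omega> + b * t n \<omega> - (a * s k \<omega> + b * t k \<omega>)\<bar> \<le>
          (\<bar>a\<bar> + 1) * \<bar>s n \<omega> - s k \<omega>\<bar> + (\<bar>b\<bar> + 1) * \<bar>t n \<omega> - t k \<omega>\<bar>"
          using split by simp
      qed
      moreover have "(\<bar>a\<bar> + 1) * int_s (\<lambda>\<omega>. \<bar>s n \<omega> - s k \<omega>\<bar>) < e / 2"
        "(\<bar>b\<bar> + 1) * int_s (\<lambda>\<omega>. \<bar>t n \<omega> - t k \<omega>\<bar>) < e / 2"
        using n1[of n k] n2[of n k] nk by (simp_all add: field_simps)
      ultimately show ?thesis by simp
    qed
    then show "\<exists>n0. \<forall>n\<ge>n0. \<forall>k\<ge>n0.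
        int_s (\<lambda>\<omega>. \<bar>a * s n \<omega> + b * t n \<omega> - (a * s k \<omega> + b * t k \<omega>)\<bar>) < e"
      by blast
  }
qed

lemma defining_seq_convergent:
  assumes s: "defining_seq s f" shows "convergent (\<lambda>n. int_s (s n))"
proof (rule Cauchy_convergent, rule CauchyI)
  fix e :: real assume "0 < e"
  then obtain n0 where n0: "\<And>n k. n0 \<le> n \<Longrightarrow> n0 \<le> k \<Longrightarrow> int_s (\<lambda>\<omega>. \<bar>s n \<omega> - s k \<omega>\<bar>) < e"
    using defining_seq_cauchy[OF s] by blast
  have "norm (int_s (s m) - int_s (s n)) < e" if "n0 \<le> m" "n0 \<le> n" for m n
    using abs_int_s_diff_le[OF defining_seq_simple[OF s] defining_seq_simple[OF s], of m n]
      n0[OF that] by simp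
  then show "\<exists>M. \<forall>m\<ge>M. \<forall>n\<ge>M. norm (int_s (s m) - int_s (s n)) < e" by blast
qed

text \<open>Existence and value are asserted together, so linear combinations can be formed before
  uniqueness is known; the definite description in \<open>fa_integral\<close> needs that
  uniqueness.\<close>

definition has_fa_integral :: "('a \<Rightarrow> real) \<Rightarrow> real \<Rightarrow> bool" where
  "has_fa_integral f I \<longleftrightarrow> (\<exists>s. defining_seq s f \<and> (\<lambda>n. int_s (s n)) \<longlonglongrightarrow> I)"

lemma has_fa_integral_linear:
  assumes "has_fa_integral f I" "has_fa_integral g J"
  shows "has_fa_integral (\<lambda>\<omega>. a * f \<omega> + b * g \<omega>) (a * I + b * J)"
proof -
  obtain s t where s: "defining_seq s f" "(\<lambda>n. int_s (s n)) \<longlonglongrightarrow> I"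
    and t: "defining_seq t g" "(\<lambda>n. int_s (t n)) \<longlonglongrightarrow> J"
    using assms by (auto simp: has_fa_integral_def)
  have "(\<lambda>n. a * int_s (s n) + b * int_s (t n)) \<longlonglongrightarrow> a * I + b * J"
    by (intro tendsto_intros s t)
  then have "(\<lambda>n. int_s (\<lambda>\<omega>. a * s n \<omega> + b * t n \<omega>)) \<longlonglongrightarrow> a * I + b * J"
    by (simp add: int_s_linear[OF defining_seq_simple[OF s(1)] defining_seq_simple[OF t(1)]])
  then show ?thesis
    using defining_seq_linear[OF s(1) t(1), of a b] unfolding has_fa_integral_def by blast
qed

text \<open>The negative parts of a defining sequence exceed \<open>c\<close> only where the
  sequence is far from \<open>f\<close> or \<open>f\<close> is negative, and they are Cauchy in mean
  because taking negative parts is 1-Lipschitz. So their integrals tend to 0, and adding them to the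
  sequence makes it nonnegative. Tolerating an outer-null set is what later turns null gaps into
  affine pieces.\<close>

lemma has_fa_integral_nonneg:
  assumes "has_fa_integral f I" and null: "fa_outer R \<mu> {\<omega>\<in>\<Omega>. f \<omega> < 0} = 0"
  shows "0 \<le> I"
proof -
  obtain s where s: "defining_seq s f" and I: "(\<lambda>n. int_s (s n)) \<longlonglongrightarrow> I"
    using assms(1) by (auto simp: has_fa_integral_def)
  note ss = defining_seq_simple[OF s]
  define d where "d = (\<lambda>n \<omega>. max 0 (- s n \<omega>))"
  have d: "simple_map 0 (d n)" for n
    using simple_map_comp[OF ss, of "\<lambda>x. max 0 (- x)"] by (simp add: d_def)
  have "(\<lambda>n. int_s (d n)) \<longlonglongrightarrow> 0"
  proof (rule int_s_tendsto_0[OF d])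
    show "0 \<le> d n \<omega>" for n \<omega> by (simp add: d_def)
    fix c :: real assume "0 < c"
    show "(\<lambda>n. fa_outer R \<mu> {\<omega>\<in>\<Omega>. c < d n \<omega>}) \<longlonglongrightarrow> 0"
    proof (rule fa_outer_tendsto_0_subset)
      show "(\<lambda>n. fa_outer R \<mu> {\<omega>\<in>\<Omega>. c < \<bar>s n \<omega> - f \<omega>\<bar>}) \<longlonglongrightarrow> 0"
        by (rule defining_seq_conv[OF s \<open>0 < c\<close>])
      show "(\<lambda>n::nat. fa_outer R \<mu> {\<omega>\<in>\<Omega>. f \<omega> < 0}) \<longlonglongrightarrow> 0"
        by (simp add: null)
      show "{\<omega>\<in>\<Omega>. c < d n \<omega>} \<subseteq> {\<omega>\<in>\<Omega>. c < \<bar>s n \<omega> - f \<omega>\<bar>} \<union> {\<omega>\<in>\<Omega>. f \<omega> < 0}" for n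
        using \<open>0 < c\<close> by (auto simp: d_def)
    qed
  next
    fix e :: real assume "0 < e"
    then obtain n0 where n0: "\<And>n k. n0 \<le> n \<Longrightarrow> n0 \<le> k \<Longrightarrow> int_s (\<lambda>\<omega>. \<bar>s n \<omega> - s k \<omega>\<bar>) < e"
      using defining_seq_cauchy[OF s] by blast
    have "int_s (\<lambda>\<omega>. \<bar>d n \<omega> - d k \<omega>\<bar>) \<le> int_s (\<lambda>\<omega>. \<bar>s n \<omega> - s k \<omega>\<bar>)" for n k
      by (intro int_s_mono simple_map_abs_diff d ss) (auto simp: d_def)
    then show "\<exists>n0. \<forall>n\<ge>n0. \<forall>k\<ge>n0. int_s (\<lambda>\<omega>. \<bar>d n \<omega> - d k \<omega>\<bar>) < e"
      using n0 by (meson le_less_trans)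
  qed
  then have lim: "(\<lambda>n. 1 * int_s (s n) + 1 * int_s (d n)) \<longlonglongrightarrow> 1 * I + 1 * 0"
    by (intro tendsto_intros I)
  have "0 \<le> 1 * int_s (s n) + 1 * int_s (d n)" for n
    unfolding int_s_linear[OF ss d, symmetric]
    by (intro int_s_nonneg simple_map_linear ss d) (auto simp: d_def)
  then show ?thesis using LIMSEQ_le_const[OF lim] by simp
qed

text \<open>\<open>I - J\<close> and \<open>J - I\<close> are both integrals of
  \<open>f - f\<close>, a function that is nowhere negative, so both are nonnegative.\<close>

lemma has_fa_integral_unique:
  assumes "has_fa_integral f I" "has_fa_integral f J" shows "I = J"
proof -
  have "J \<le> I" if "has_fa_integral f I" "has_fa_integral f J" for I J
    using has_fa_integral_nonneg[OF has_fa_integral_linear[OF that, of 1 "-1"]]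
    by (simp add: fa_outer_empty)
  from this[OF assms] this[OF assms(2,1)] show ?thesis by simp
qed

lemma has_fa_integralD:
  assumes "has_fa_integral f I"
  shows "f \<in> fa_L1 \<Omega> R \<mu>" "fa_integral \<Omega> R \<mu> f = I"
proof -
  show "f \<in> fa_L1 \<Omega> R \<mu>" using assms by (auto simp: has_fa_integral_def fa_L1_def)
  have "fa_integral \<Omega> R \<mu> f = (THE I. has_fa_integral f I)"
    by (simp add: fa_integral_def has_fa_integral_def)
  then show "fa_integral \<Omega> R \<mu> f = I"
    using the_equality[where P = "has_fa_integral f", OF assms has_fa_integral_unique[OF _ assms]] by simp
qed

lemma has_fa_integral_fa_integral:
  assumes "f \<in> fa_L1 \<Omega> R \<mu>" shows "has_fa_integral f (fa_integral \<Omega> R \<mu> f)"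
proof -
  obtain I where "has_fa_integral f I"
    using assms defining_seq_convergent
    by (fastforce simp: has_fa_integral_def fa_L1_def convergent_def)
  then show ?thesis using has_fa_integralD(2) by simp
qed

end


section \<open>Representable functions are convex\<close>

definition kink :: "ereal \<Rightarrow> real \<Rightarrow> real \<Rightarrow> real" where
  "kink x0 x t = (if x0 < ereal x then max 0 (t - x) else max 0 (x - t))"

lemma hfun_eq_kink: "u \<le> v \<Longrightarrow> hfun x0 u v x = kink x0 x v - kink x0 x u"
  by (auto simp: hfun_def kink_def max_def min_def not_less)

text \<open>Integrability is demanded for all \<open>u\<close> and \<open>v\<close>; this settles
  the pairs in reversed order.\<close>

lemma hfun_eq_0: "v \<le> u \<Longrightarrow> hfun x0 u v x = 0"
  by (auto simp: hfun_def max_def min_def)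

lemma kink_convex:
  assumes "0 \<le> t" "t \<le> 1"
  shows "kink x0 x ((1 - t) * u + t * v) \<le> (1 - t) * kink x0 x u + t * kink x0 x v"
proof -
  have *: "max 0 ((1 - t) * a + t * b) \<le> (1 - t) * max 0 a + t * max 0 b" for a b :: real
    using assms by (intro max.boundedI add_nonneg_nonneg mult_nonneg_nonneg add_mono mult_left_mono) auto
  show ?thesis using *[of "u - x" "v - x"] *[of "x - u" "x - v"]
    by (auto simp: kink_def algebra_simps)
qed

text \<open>The positive part is linear on numbers of one sign, and an \<open>x\<close> outside the
  open interval never gives \<open>u - x\<close> and \<open>v - x\<close> opposite strict
  signs.\<close>

lemma kink_affine:
  assumes "0 \<le> t" "t \<le> 1" "x \<le> u \<or> v \<le> x" "u \<le> v"
  shows "kink x0 x ((1 - t) * u + t * v) = (1 - t) * kink x0 x u + t * kink x0 x v"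
proof -
  have *: "max 0 ((1 - t) * a + t * b) = (1 - t) * max 0 a + t * max 0 b"
    if "0 \<le> a \<and> 0 \<le> b \<or> a \<le> 0 \<and> b \<le> 0" for a b :: real
    using that
  proof
    assume "0 \<le> a \<and> 0 \<le> b"
    then show ?thesis using assms(1,2) by simp
  next
    assume "a \<le> 0 \<and> b \<le> 0"
    then have "(1 - t) * a \<le> 0" "t * b \<le> 0"
      using assms(1,2) by (auto intro: mult_nonneg_nonpos)
    then show ?thesis using \<open>a \<le> 0 \<and> b \<le> 0\<close> by (simp add: max_absorb1)
  qed
  show ?thesis using *[of "u - x" "v - x"] *[of "x - u" "x - v"] assms(3,4)
    by (auto simp: kink_def algebra_simps)
qed

text \<open>The common content of (ii) and (iii): a general \<open>X\<close> on
  \<open>\<Omega>\<close> for the former, the identity on the line for the latter.\<close>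

locale fa_representation = measure_struct \<Omega> R \<mu>
  for \<Omega> :: "'a set" and R and \<mu> :: "'a set \<Rightarrow> real" +
  fixes \<phi> :: "real \<Rightarrow> real" and x0 :: ereal and X :: "'a \<Rightarrow> real"
  assumes L1: "\<And>u v. (\<lambda>\<omega>. hfun x0 u v (X \<omega>)) \<in> fa_L1 \<Omega> R \<mu>"
    and rep: "\<And>u v. u \<le> v \<Longrightarrow> \<phi> v = \<phi> u + fa_integral \<Omega> R \<mu> (\<lambda>\<omega>. hfun x0 u v (X \<omega>))"
begin

lemma has_fa_integral_hfun:
  "u \<le> v \<Longrightarrow> has_fa_integral (\<lambda>\<omega>. hfun x0 u v (X \<omega>)) (\<phi> v - \<phi> u)"
  using has_fa_integral_fa_integral[OF L1] rep by simp

text \<open>A kink need not be integrable, but its increments in \<open>t\<close> are. The gap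
  between chord and kink is \<open>t\<close> times the increment from \<open>u\<close> to
  \<open>v\<close> minus the increment from \<open>u\<close> to \<open>w\<close>.\<close>

lemma has_fa_integral_chord:
  assumes "u \<le> v" "0 \<le> t" "t \<le> 1"
  defines "w \<equiv> (1 - t) * u + t * v"
  shows "has_fa_integral
    (\<lambda>\<omega>. (1 - t) * kink x0 (X \<omega>) u + t * kink x0 (X \<omega>) v - kink x0 (X \<omega>) w)
    ((1 - t) * \<phi> u + t * \<phi> v - \<phi> w)"
proof -
  have "u \<le> w"
    using assms(1,2) mult_left_mono[of u v t] by (auto simp: w_def algebra_simps)
  then show ?thesis
    using has_fa_integral_linear[OF has_fa_integral_hfun[OF \<open>u \<le> v\<close>] has_fa_integral_hfun[OF \<open>u \<le> w\<close>],
        of t "-1"] assms(1)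
    by (simp add: hfun_eq_kink algebra_simps)
qed

lemma convex: "convex_on UNIV \<phi>"
proof (rule convex_on_linorderI)
  fix t x y :: real assume t: "0 < t" "t < 1" and xy: "x < y"
  have "0 \<le> (1 - t) * \<phi> x + t * \<phi> y - \<phi> ((1 - t) * x + t * y)"
  proof (rule has_fa_integral_nonneg[OF has_fa_integral_chord])
    show "x \<le> y" "0 \<le> t" "t \<le> 1" using t xy by auto
    have "\<not> (1 - t) * kink x0 z x + t * kink x0 z y - kink x0 z ((1 - t) * x + t * y) < 0" for z
      using kink_convex[of t x0 z x y] t by simp
    then show "fa_outer R \<mu> {\<omega>\<in>\<Omega>. (1 - t) * kink x0 (X \<omega>) x + t * kink x0 (X \<omega>) y -
        kink x0 (X \<omega>) ((1 - t) * x + t * y) < 0} = 0"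
      by (simp add: fa_outer_empty)
  qed
  then show "\<phi> ((1 - t) *\<^sub>R x + t *\<^sub>R y) \<le> (1 - t) * \<phi> x + t * \<phi> y" by simp
qed simp

text \<open>Convexity is one inequality. For the other, the chord gap with reversed sign can be
  negative only where \<open>u < X < v\<close>, an outer-null set, so its integral is nonnegative
  too.\<close>

lemma affine_on_gap:
  assumes "u \<le> v" and null: "fa_outer R \<mu> {\<omega>\<in>\<Omega>. u < X \<omega> \<and> X \<omega> < v} = 0"
    and t: "0 \<le> t" "t \<le> 1"
  shows "\<phi> ((1 - t) * u + t * v) = (1 - t) * \<phi> u + t * \<phi> v"
proof (rule antisym)
  show "\<phi> ((1 - t) * u + t * v) \<le> (1 - t) * \<phi> u + t * \<phi> v"
    using convex_onD[OF convex, of t u v] t by simp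
  let ?w = "(1 - t) * u + t * v"
  have "has_fa_integral
      (\<lambda>\<omega>. kink x0 (X \<omega>) ?w - ((1 - t) * kink x0 (X \<omega>) u + t * kink x0 (X \<omega>) v))
      (\<phi> ?w - ((1 - t) * \<phi> u + t * \<phi> v))"
    using has_fa_integral_linear[OF has_fa_integral_chord[OF assms(1) t] has_fa_integral_chord[OF assms(1) t],
        of "-1" 0] by simp
  moreover have "fa_outer R \<mu> {\<omega>\<in>\<Omega>. kink x0 (X \<omega>) ?w -
      ((1 - t) * kink x0 (X \<omega>) u + t * kink x0 (X \<omega>) v) < 0} = 0"
  proof -
    have "{\<omega>\<in>\<Omega>. kink x0 (X \<omega>) ?w - ((1 - t) * kink x0 (X \<omega>) u + t * kink x0 (X \<omega>) v) < 0} \<subseteq>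
        {\<omega>\<in>\<Omega>. u < X \<omega> \<and> X \<omega> < v}"
      using kink_affine[OF t _ assms(1), of _ x0] by (force simp: not_less)
    from fa_outer_mono[OF this] null show ?thesis by simp
  qed
  ultimately show "(1 - t) * \<phi> u + t * \<phi> v \<le> \<phi> ?w"
    using has_fa_integral_nonneg by fastforce
qed

lemma gap_derivs:
  assumes "u < v" and null: "fa_outer R \<mu> {\<omega>\<in>\<Omega>. u < X \<omega> \<and> X \<omega> < v} = 0"
  shows "has_left_deriv \<phi> (ereal v) ((\<phi> v - \<phi> u) / (v - u))"
    "has_right_deriv \<phi> (ereal u) ((\<phi> v - \<phi> u) / (v - u))"
proof -
  define m where "m = (\<phi> v - \<phi> u) / (v - u)"
  have affine: "\<phi> w = \<phi> u + m * (w - u)" if w: "u \<le> w" "w \<le> v" for w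
  proof -
    define t where "t = (w - u) / (v - u)"
    have t: "0 \<le> t" "t \<le> 1" using w assms(1) by (auto simp: t_def field_simps)
    have tv: "t * (v - u) = w - u" using assms(1) by (simp add: t_def)
    then have "w = (1 - t) * u + t * v" by (simp add: algebra_simps)
    then have "\<phi> w = (1 - t) * \<phi> u + t * \<phi> v"
      using affine_on_gap[OF less_imp_le[OF assms(1)] null t] by simp
    also have "\<dots> = \<phi> u + m * (w - u)"
    proof -
      have "m * (w - u) = t * (\<phi> v - \<phi> u)"
        unfolding tv[symmetric] using assms(1) by (simp add: m_def)
      then show ?thesis by (simp add: algebra_simps)
    qed
    finally show ?thesis .
  qed
  have D: "((\<lambda>w. \<phi> u + m * (w - u)) has_real_derivative m) (at z within S)" for z S
    by (auto intro!: derivative_eq_intros)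
  have ev_left: "\<forall>\<^sub>F w in at_left v. \<phi> w = \<phi> u + m * (w - u)"
    unfolding eventually_at_left[OF assms(1)] using assms(1) by (intro exI[of _ u] conjI allI impI affine) auto
  have "(\<phi> has_real_derivative m) (at_left v)"
    by (rule has_field_derivative_cong_eventually[THEN iffD2, OF ev_left _ D])
       (use assms(1) affine[of v] in simp)
  moreover have ev_right: "\<forall>\<^sub>F w in at_right u. \<phi> w = \<phi> u + m * (w - u)"
    unfolding eventually_at_right[OF assms(1)] using assms(1) by (intro exI[of _ v] conjI allI impI affine) auto
  moreover have "(\<phi> has_real_derivative m) (at_right u)"
    by (rule has_field_derivative_cong_eventually[THEN iffD2, OF ev_right _ D]) simp
  ultimately show "has_left_deriv \<phi> (ereal v) ((\<phi> v - \<phi> u) / (v - u))"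
    "has_right_deriv \<phi> (ereal u) ((\<phi> v - \<phi> u) / (v - u))"
    by (simp_all add: has_left_deriv_def has_right_deriv_def m_def)
qed

end

section \<open>One-sided derivatives of convex functions\<close>

locale convex_function =
  fixes \<phi> :: "real \<Rightarrow> real"
  assumes convex: "convex_on UNIV \<phi>"
begin

definition slope :: "real \<Rightarrow> real \<Rightarrow> real" where
  "slope x y = (\<phi> y - \<phi> x) / (y - x)"

text \<open>Secant slopes increase in each endpoint, so this infimum is the limit from the right. As
  an infimum it compares with every slope without any limit argument.\<close>

definition rd :: "real \<Rightarrow> real" where "rd x = (INF y\<in>{x<..}. slope x y)"

definition ld :: "real \<Rightarrow> real" where "ld x = (SUP w\<in>{..<x}. slope w x)"

lemma slope_commute: "slope x y = (\<phi> x - \<phi> y) / (x - y)"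
  by (metis slope_def minus_diff_eq minus_divide_divide)

lemma slope_mono:
  assumes "x < y" "y < z"
  shows "slope x y \<le> slope x z" "slope x z \<le> slope y z"
  using convex_on_slope_le[OF convex, of x z y] assms by (simp_all add: slope_commute)

lemma rd_le_slope:
  assumes "x < y" shows "rd x \<le> slope x y"
  unfolding rd_def
proof (rule cINF_lower)
  \<comment> \<open>Every slope that ends at \<open>x\<close> lies below every slope that starts
    there; \<open>x - 1\<close> is an arbitrary choice of left point.\<close>
  have "slope (x - 1) x \<le> slope x y" if "x < y" for y
    using slope_mono[of "x - 1" x y] that by simp
  then show "bdd_below (slope x ` {x<..})" by (intro bdd_belowI2[of _ "slope (x - 1) x"]) auto
qed (use assms in simp)

lemma slope_le_ld:
  assumes "w < x" shows "slope w x \<le> ld x"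
  unfolding ld_def
proof (rule cSUP_upper)
  have "slope w x \<le> slope x (x + 1)" if "w < x" for w
    using slope_mono[of w x "x + 1"] that by simp
  then show "bdd_above ((\<lambda>w. slope w x) ` {..<x})" by (intro bdd_aboveI2[of _ _ "slope x (x + 1)"]) auto
qed (use assms in simp)

lemma ld_le_rd: "ld x \<le> rd x"
  unfolding ld_def rd_def
proof (intro cSUP_least cINF_greatest)
  fix w y assume "w \<in> {..<x}" "y \<in> {x<..}"
  then show "slope w x \<le> slope x y" using slope_mono[of w x y] by simp
qed auto

lemma rd_le_ld: "x < y \<Longrightarrow> rd x \<le> ld y"
  using rd_le_slope[of x y] slope_le_ld[of x y] by simp

lemma rd_mono: "x \<le> y \<Longrightarrow> rd x \<le> rd y"
  using rd_le_ld[of x y] ld_le_rd[of y] by (cases "x = y") auto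

text \<open>These two bounds are all that the Riemann sums need in order to treat \<open>rd\<close>
  as the density of \<open>\<phi>\<close>.\<close>

lemma rd_bounds:
  assumes "p \<le> q"
  shows "(q - p) * rd p \<le> \<phi> q - \<phi> p" "\<phi> q - \<phi> p \<le> (q - p) * rd q"
proof -
  have "(q - p) * rd p \<le> \<phi> q - \<phi> p \<and> \<phi> q - \<phi> p \<le> (q - p) * rd q" if "p < q"
  proof -
    have "\<phi> q - \<phi> p = (q - p) * slope p q" using that by (simp add: slope_def)
    moreover have "rd p \<le> slope p q" "slope p q \<le> rd q"
      using that rd_le_slope[of p q] slope_le_ld[of p q] ld_le_rd[of q] by auto
    ultimately show ?thesis using that by (simp add: mult_left_mono)
  qed
  then show "(q - p) * rd p \<le> \<phi> q - \<phi> p" "\<phi> q - \<phi> p \<le> (q - p) * rd q"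
    using assms by (cases "p = q"; simp)+
qed

lemma rd_less_slope: "rd x < a \<Longrightarrow> \<exists>y>x. slope x y < a"
  unfolding rd_def by (subst (asm) cINF_less_iff) (auto intro!: bdd_belowI2[of _ "rd x"] rd_le_slope)

lemma ld_greater_slope: "a < ld x \<Longrightarrow> \<exists>w<x. a < slope w x"
  unfolding ld_def by (subst (asm) less_cSUP_iff) (auto intro!: bdd_aboveI2[of _ _ "ld x"] slope_le_ld)

lemma right_deriv: "(\<phi> has_real_derivative rd x) (at_right x)"
  unfolding has_field_derivative_iff slope_def[symmetric]
proof (rule order_tendstoI)
  show "\<forall>\<^sub>F y in at_right x. a < slope x y" if "a < rd x" for a
    using that rd_le_slope[of x] less_le_trans
    by (intro eventually_at_rightI[of x "x + 1"]) auto
  fix a assume "rd x < a"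
  then obtain y where "x < y" "slope x y < a" using rd_less_slope by blast
  then show "\<forall>\<^sub>F y in at_right x. slope x y < a"
    using slope_mono(1)[of x _ y] le_less_trans by (intro eventually_at_rightI[of x y]) auto
qed

lemma left_deriv: "(\<phi> has_real_derivative ld x) (at_left x)"
  unfolding has_field_derivative_iff slope_commute[symmetric, of _ x]
proof (rule order_tendstoI)
  show "\<forall>\<^sub>F w in at_left x. slope w x < a" if "ld x < a" for a
    using that slope_le_ld[of _ x] le_less_trans
    by (intro eventually_at_leftI[of "x - 1" x]) auto
  fix a assume "a < ld x"
  then obtain w where "w < x" "a < slope w x" using ld_greater_slope by blast
  then show "\<forall>\<^sub>F w in at_left x. a < slope w x"
    using slope_mono(2)[of w _ x] less_le_trans by (intro eventually_at_leftI[of w x]) auto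
qed

lemma right_deriv_unique: "(\<phi> has_real_derivative D) (at_right x) \<Longrightarrow> D = rd x"
  using right_deriv[of x] tendsto_unique[OF trivial_limit_at_right_real]
  unfolding has_field_derivative_iff by blast

lemma left_deriv_unique: "(\<phi> has_real_derivative D) (at_left x) \<Longrightarrow> D = ld x"
  using left_deriv[of x] tendsto_unique[OF trivial_limit_at_left_real]
  unfolding has_field_derivative_iff by blast

lemma limit_right_deriv: "has_limit_right_deriv \<phi> F D \<Longrightarrow> (rd \<longlongrightarrow> D) F"
  unfolding has_limit_right_deriv_def
  using right_deriv_unique by (auto elim!: Lim_transform_eventually eventually_mono)

lemma continuous: "isCont \<phi> x"
  using convex_on_continuous[OF open_UNIV convex] by (simp add: continuous_on_eq_continuous_at)

lemma slope_tendsto: "x \<noteq> y \<Longrightarrow> ((\<lambda>z. slope z y) \<longlongrightarrow> slope x y) (at x)"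
  unfolding slope_def using continuous[of x] by (intro tendsto_intros) (auto simp: isCont_def)

text \<open>A slope from \<open>x\<close> to some \<open>y\<close> below \<open>a\<close> stays
  below \<open>a\<close> when \<open>x\<close> moves slightly to the right, by continuity of
  \<open>\<phi>\<close>, and it bounds \<open>rd\<close> there. Right-continuity is what a Stieltjes
  measure asks of its integrator.\<close>

lemma rd_right_limit: "(rd \<longlongrightarrow> rd x) (at_right x)"
proof (rule order_tendstoI)
  show "\<forall>\<^sub>F z in at_right x. a < rd z" if "a < rd x" for a
    using that less_le_trans[OF that rd_mono] by (intro eventually_at_rightI[of x "x + 1"]) auto
  fix a assume "rd x < a"
  then obtain y where y: "x < y" "slope x y < a" using rd_less_slope by blast
  have "\<forall>\<^sub>F z in at_right x. slope z y < a"
    using slope_tendsto[of x y] y by (intro order_tendstoD(2)[OF filterlim_mono[OF _ order_refl at_le]]) auto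
  moreover have "\<forall>\<^sub>F z in at_right x. z < y"
    using y by (intro eventually_at_rightI[of x y]) auto
  ultimately show "\<forall>\<^sub>F z in at_right x. rd z < a"
    by eventually_elim (use rd_le_slope le_less_trans in blast)
qed

text \<open>From above, \<open>rd z \<le> ld x\<close> for \<open>z < x\<close>; from below, a slope
  ending at \<open>x\<close> changes continuously with its right end \<open>z\<close> and is at most
  \<open>rd z\<close>. Hence \<open>rd x - ld x\<close> is the jump of \<open>rd\<close>.\<close>

lemma rd_left_limit: "(rd \<longlongrightarrow> ld x) (at_left x)"
proof (rule order_tendstoI)
  show "\<forall>\<^sub>F z in at_left x. rd z < a" if "ld x < a" for a
    using that le_less_trans[OF rd_le_ld that] by (intro eventually_at_leftI[of "x - 1" x]) auto
  fix a assume "a < ld x"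
  then obtain w where w: "w < x" "a < slope w x" using ld_greater_slope by blast
  have "((\<lambda>z. slope w z) \<longlongrightarrow> slope w x) (at x)"
    using slope_tendsto[of x w] w unfolding slope_commute[of w] by (simp add: slope_def[of _ w])
  then have "\<forall>\<^sub>F z in at_left x. a < slope w z"
    using w by (intro order_tendstoD(1)[OF filterlim_mono[OF _ order_refl at_le]]) auto
  moreover have "\<forall>\<^sub>F z in at_left x. w < z"
    using w by (intro eventually_at_leftI[of w x]) auto
  ultimately show "\<forall>\<^sub>F z in at_left x. a < rd z"
  proof eventually_elim
    fix z assume "a < slope w z" "w < z"
    then show "a < rd z" using slope_le_ld[of w z] ld_le_rd[of z] by linarith
  qed
qed

end


section \<open>Riemann sums\<close>

text \<open>On each cell the increment of \<open>H\<close> and the tagged term both lie between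
  \<open>\<delta>\<close> times the values of \<open>k\<close> at the two ends. The resulting errors
  telescope, so no continuity of \<open>k\<close> is involved.\<close>

lemma tagged_sum_error:
  fixes H k :: "real \<Rightarrow> real"
  assumes lower: "\<And>p q. p \<le> q \<Longrightarrow> (q - p) * k p \<le> H q - H p"
    and upper: "\<And>p q. p \<le> q \<Longrightarrow> H q - H p \<le> (q - p) * k q"
    and "u \<le> v" "0 < n"
  defines "\<delta> \<equiv> (v - u) / real n"
  assumes tag: "\<And>i. i < n \<Longrightarrow> u + \<delta> * real i \<le> t i \<and> t i \<le> u + \<delta> * real (Suc i)"
  shows "\<bar>H v - H u - (\<Sum>i<n. \<delta> * k (t i))\<bar> \<le> \<delta> * (k v - k u)"
proof -
  define p where "p i = u + \<delta> * real i" for i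
  have \<delta>: "0 \<le> \<delta>" using assms(3,4) by (simp add: \<delta>_def)
  have p: "p 0 = u" "p n = v" "p (Suc i) - p i = \<delta>" for i
    using assms(4) by (simp add: p_def, simp add: p_def \<delta>_def, simp add: p_def distrib_left)
  \<comment> \<open>The two bounds on the increments of \<open>H\<close> already force
    \<open>k\<close> to be monotone.\<close>
  have mono: "k a \<le> k b" if "a \<le> b" for a b
    using order_trans[OF lower upper, OF that that] that by (cases "a = b") (auto simp: mult_le_cancel_left)
  have H: "H v - H u = (\<Sum>i<n. H (p (Suc i)) - H (p i))"
    using sum_lessThan_telescope[of "\<lambda>i. H (p i)" n] p by simp
  have "\<bar>H v - H u - (\<Sum>i<n. \<delta> * k (t i))\<bar> = \<bar>\<Sum>i<n. (H (p (Suc i)) - H (p i)) - \<delta> * k (t i)\<bar>"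
    unfolding H by (simp add: sum_subtractf)
  also have "\<dots> \<le> (\<Sum>i<n. \<bar>(H (p (Suc i)) - H (p i)) - \<delta> * k (t i)\<bar>)" by (rule sum_abs)
  also have "\<dots> \<le> (\<Sum>i<n. \<delta> * k (p (Suc i)) - \<delta> * k (p i))"
  proof (rule sum_mono)
    fix i assume "i \<in> {..<n}"
    then have t: "p i \<le> t i" "t i \<le> p (Suc i)" using tag[of i] by (auto simp: p_def)
    have "\<delta> * k (p i) \<le> \<delta> * k (t i)" "\<delta> * k (t i) \<le> \<delta> * k (p (Suc i))"
      using \<delta> t by (auto intro!: mult_left_mono mono)
    moreover have "\<delta> * k (p i) \<le> H (p (Suc i)) - H (p i)" "H (p (Suc i)) - H (p i) \<le> \<delta> * k (p (Suc i))"
      using lower[of "p i" "p (Suc i)"] upper[of "p i" "p (Suc i)"] p(3)[of i] t by auto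
    ultimately show "\<bar>(H (p (Suc i)) - H (p i)) - \<delta> * k (t i)\<bar> \<le> \<delta> * k (p (Suc i)) - \<delta> * k (p i)"
      by linarith
  qed
  also have "\<dots> = \<delta> * (k v - k u)"
    using sum_lessThan_telescope[of "\<lambda>i. \<delta> * k (p i)" n] p by (simp add: right_diff_distrib)
  finally show ?thesis .
qed

text \<open>\<open>k\<close> is the right derivative of the kink in \<open>t\<close>: a unit step,
  from 0 to 1 or from -1 to 0 according to the side of \<open>x0\<close>.\<close>

lemma kink_bounds:
  defines "k \<equiv> \<lambda>x0 x t. of_bool (x0 < ereal x \<and> x \<le> t) - of_bool (ereal x \<le> x0 \<and> t < x) :: real"
  assumes "p \<le> q"
  shows "(q - p) * k x0 x p \<le> kink x0 x q - kink x0 x p" "kink x0 x q - kink x0 x p \<le> (q - p) * k x0 x q"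
  using assms(2) by (auto simp: k_def kink_def max_def of_bool_def not_less)

context measure_struct
begin

lemma
  assumes "finite I" "\<And>i. i \<in> I \<Longrightarrow> simple_map 0 (f i :: 'a \<Rightarrow> real)"
  shows simple_map_sum: "simple_map 0 (\<lambda>\<omega>. \<Sum>i\<in>I. f i \<omega>)"
    and int_s_sum: "int_s (\<lambda>\<omega>. \<Sum>i\<in>I. f i \<omega>) = (\<Sum>i\<in>I. int_s (f i))"
proof -
  have "simple_map 0 (\<lambda>\<omega>. \<Sum>i\<in>I. f i \<omega>) \<and> int_s (\<lambda>\<omega>. \<Sum>i\<in>I. f i \<omega>) = (\<Sum>i\<in>I. int_s (f i))"
    using assms
  proof (induction I rule: finite_induct)
    case empty
    show ?case
      using simple_map_indicator[OF empty_sets, of 0] int_s_indicator[OF empty_sets, of 0] by simp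
  next
    case (insert i I)
    then have i: "simple_map 0 (f i)" and I: "simple_map 0 (\<lambda>\<omega>. \<Sum>i\<in>I. f i \<omega>)"
      "int_s (\<lambda>\<omega>. \<Sum>i\<in>I. f i \<omega>) = (\<Sum>i\<in>I. int_s (f i))"
      by auto
    show ?case
      using simple_map_add[OF i I(1)] int_s_linear[OF i I(1), of 1 1] insert.hyps by (simp add: I(2))
  qed
  then show "simple_map 0 (\<lambda>\<omega>. \<Sum>i\<in>I. f i \<omega>)"
    "int_s (\<lambda>\<omega>. \<Sum>i\<in>I. f i \<omega>) = (\<Sum>i\<in>I. int_s (f i))" by auto
qed

lemma has_fa_integral_zero: "has_fa_integral (\<lambda>_. 0) 0"
proof -
  have "int_s (\<lambda>_. 0) = 0" using int_s_indicator[OF empty_sets, of 0] by simp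
  moreover have "simple_map 0 (\<lambda>_. 0 :: real)" using simple_map_indicator[OF empty_sets, of 0] by simp
  ultimately have "defining_seq (\<lambda>_ _. 0) (\<lambda>_. 0)"
    by (auto simp: fa_defining_seq_def fa_converges_def fa_simple_iff fa_outer_empty)
  then show ?thesis using \<open>int_s (\<lambda>_. 0) = 0\<close> by (auto simp: has_fa_integral_def)
qed

end

text \<open>
  Both \<open>\<phi>\<close> and \<open>kink x0 x\<close> are integrals of monotone functions, namely of \<open>g\<close> and of
  \<open>t \<mapsto> 1{x0 < x \<le> t} - 1{t < x \<le> x0}\<close>. Riemann sums with the same tags therefore approximate
  \<open>hfun x0 u v\<close> uniformly by simple functions, and their integrals are Riemann sums for \<open>\<phi> v - \<phi> u\<close>.
\<close>

locale fa_density = measure_struct \<Omega> R \<mu>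
  for \<Omega> :: "'a set" and R and \<mu> :: "'a set \<Rightarrow> real" +
  fixes \<phi> g :: "real \<Rightarrow> real" and C :: "real set" and x0 :: ereal and X :: "'a \<Rightarrow> real"
  assumes dense: "\<And>a b::real. a < b \<Longrightarrow> \<exists>t\<in>C. a < t \<and> t < b"
    and P: "\<And>t. t \<in> C \<Longrightarrow> {\<omega>\<in>\<Omega>. x0 < ereal (X \<omega>) \<and> X \<omega> \<le> t} \<in> R"
    and Q: "\<And>t. t \<in> C \<Longrightarrow> {\<omega>\<in>\<Omega>. ereal (X \<omega>) \<le> x0 \<and> t < X \<omega>} \<in> R"
    and \<mu>: "\<And>t. t \<in> C \<Longrightarrow> \<mu> {\<omega>\<in>\<Omega>. x0 < ereal (X \<omega>) \<and> X \<omega> \<le> t} -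
      \<mu> {\<omega>\<in>\<Omega>. ereal (X \<omega>) \<le> x0 \<and> t < X \<omega>} = g t"
    and lower: "\<And>p q. p \<le> q \<Longrightarrow> (q - p) * g p \<le> \<phi> q - \<phi> p"
    and upper: "\<And>p q. p \<le> q \<Longrightarrow> \<phi> q - \<phi> p \<le> (q - p) * g q"
begin

lemma has_fa_integral_hfun_less:
  assumes "u < v" shows "has_fa_integral (\<lambda>\<omega>. hfun x0 u v (X \<omega>)) (\<phi> v - \<phi> u)"
proof -
  define PP where "PP t = {\<omega>\<in>\<Omega>. x0 < ereal (X \<omega>) \<and> X \<omega> \<le> t}" for t
  define QQ where "QQ t = {\<omega>\<in>\<Omega>. ereal (X \<omega>) \<le> x0 \<and> t < X \<omega>}" for t
  define k where "k x t = (of_bool (x0 < ereal x \<and> x \<le> t) - of_bool (ereal x \<le> x0 \<and> t < x) :: real)"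
    for x t
  \<comment> \<open>\<open>Suc n\<close> guarantees at least one cell, so that the mesh is positive
    for every \<open>n\<close>.\<close>
  define \<delta> where "\<delta> n = (v - u) / real (Suc n)" for n
  have \<delta>_pos: "0 < \<delta> n" for n using \<open>u < v\<close> by (simp add: \<delta>_def)
  have \<delta>_lim: "\<delta> \<longlonglongrightarrow> 0"
    unfolding \<delta>_def by (intro real_tendsto_divide_at_top[OF tendsto_const]
      filterlim_compose[OF filterlim_real_sequentially filterlim_Suc])
  have "\<exists>t. t \<in> C \<and> u + \<delta> n * real i < t \<and> t < u + \<delta> n * real (Suc i)" for n i
    using dense[of "u + \<delta> n * real i" "u + \<delta> n * real (Suc i)"] \<delta>_pos[of n] by (auto simp: algebra_simps)
  then obtain t where t: "\<And>n i. t n i \<in> C" "\<And>n i. u + \<delta> n * real i < t n i"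
    "\<And>n i. t n i < u + \<delta> n * real (Suc i)"
    by metis
  have tag: "u + (v - u) / real (Suc n) * real i \<le> t n i \<and> t n i \<le> u + (v - u) / real (Suc n) * real (Suc i)"
    for n i
    using t(2)[of n i] t(3)[of n i] by (simp add: \<delta>_def less_imp_le)
  define s where "s = (\<lambda>n \<omega>. \<Sum>i<Suc n. \<delta> n * indicator (PP (t n i)) \<omega> + (- \<delta> n) * indicator (QQ (t n i)) \<omega>)"
  have PR: "PP (t n i) \<in> R" and QR: "QQ (t n i) \<in> R" for n i
    using P Q t(1) by (auto simp: PP_def QQ_def)
  have trm: "simple_map 0 (\<lambda>\<omega>. \<delta> n * indicator (PP (t n i)) \<omega> + (- \<delta> n) * indicator (QQ (t n i)) \<omega> :: real)"
    "int_s (\<lambda>\<omega>. \<delta> n * indicator (PP (t n i)) \<omega> + (- \<delta> n) * indicator (QQ (t n i)) \<omega>) = \<delta> n * g (t n i)"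
    for n i
  proof -
    have ind: "simple_map 0 (indicator (PP (t n i)) :: 'a \<Rightarrow> real)" "simple_map 0 (indicator (QQ (t n i)) :: 'a \<Rightarrow> real)"
      using simple_map_indicator[OF PR, of 1 n i] simple_map_indicator[OF QR, of 1 n i] by simp_all
    show "simple_map 0 (\<lambda>\<omega>. \<delta> n * indicator (PP (t n i)) \<omega> + (- \<delta> n) * indicator (QQ (t n i)) \<omega> :: real)"
      by (rule simple_map_linear[OF ind])
    have "int_s (indicator (PP (t n i))) = \<mu> (PP (t n i))" "int_s (indicator (QQ (t n i))) = \<mu> (QQ (t n i))"
      using int_s_indicator[OF PR, of 1 n i] int_s_indicator[OF QR, of 1 n i] by simp_all
    then show "int_s (\<lambda>\<omega>. \<delta> n * indicator (PP (t n i)) \<omega> + (- \<delta> n) * indicator (QQ (t n i)) \<omega>) = \<delta> n * g (t n i)"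
      using \<mu>[OF t(1)[of n i]] int_s_linear[OF ind, of "\<delta> n" "- \<delta> n"]
      by (simp add: PP_def[symmetric] QQ_def[symmetric] algebra_simps)
  qed
  have s: "simple_map 0 (s n)" for n
    unfolding s_def by (intro simple_map_sum trm) simp
  have int_s: "int_s (s n) = (\<Sum>i<Suc n. \<delta> n * g (t n i))" for n
    unfolding s_def using trm by (subst int_s_sum) auto
  have approx: "\<bar>hfun x0 u v (X \<omega>) - s n \<omega>\<bar> \<le> \<delta> n" if "\<omega> \<in> \<Omega>" for n \<omega>
  proof -
    have "s n \<omega> = (\<Sum>i<Suc n. \<delta> n * k (X \<omega>) (t n i))"
      unfolding s_def using that by (intro sum.cong) (auto simp: PP_def QQ_def k_def indicator_def)
    moreover have "\<bar>kink x0 (X \<omega>) v - kink x0 (X \<omega>) u - (\<Sum>i<Suc n. \<delta> n * k (X \<omega>) (t n i))\<bar>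
        \<le> \<delta> n * (k (X \<omega>) v - k (X \<omega>) u)"
      unfolding \<delta>_def k_def using \<open>u < v\<close> tag
      by (intro tagged_sum_error kink_bounds) auto
    \<comment> \<open>\<open>k\<close> rises by at most 1 between \<open>u\<close> and
      \<open>v\<close>, so the error is bounded by the mesh, uniformly in
      \<open>\<omega>\<close>.\<close>
    moreover have "\<delta> n * (k (X \<omega>) v - k (X \<omega>) u) \<le> \<delta> n * 1"
      using \<delta>_pos[of n] \<open>u < v\<close> by (intro mult_left_mono) (auto simp: k_def not_less)
    ultimately show ?thesis using \<open>u < v\<close> by (simp add: hfun_eq_kink)
  qed
  obtain a b where ab: "a \<in> C" "a < u" "b \<in> C" "v < b"
    using dense[of "u - 1" u] dense[of v "v + 1"] by auto
  \<comment> \<open>All tags lie between \<open>a\<close> and \<open>b\<close>, so this one member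
    of the ring carries every \<open>s n\<close>; its finite measure turns uniform closeness into
    closeness in mean.\<close>
  define D where "D = PP b \<union> QQ a"
  have D: "D \<in> R" using P[OF ab(3)] Q[OF ab(1)] unfolding D_def PP_def QQ_def by (rule Un)
  have diff: "\<bar>s n \<omega> - s m \<omega>\<bar> \<le> (\<delta> n + \<delta> m) * indicator D \<omega>" for n m \<omega>
  proof (cases "\<omega> \<in> D")
    case True
    then have "\<omega> \<in> \<Omega>" by (auto simp: D_def PP_def QQ_def)
    then show ?thesis using approx[of \<omega> n] approx[of \<omega> m] True by simp
  next
    case False
    have "s n \<omega> = 0" for n
      unfolding s_def
    proof (rule sum.neutral, rule ballI)
      fix i assume "i \<in> {..<Suc n}"
      then have "\<delta> n * real (Suc i) \<le> \<delta> n * real (Suc n)" "0 \<le> \<delta> n * real i"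
        using \<delta>_pos[of n] by (auto intro!: mult_left_mono)
      moreover have "\<delta> n * real (Suc n) = v - u" by (simp add: \<delta>_def)
      ultimately have "a < t n i" "t n i < b" using t(2)[of n i] t(3)[of n i] ab by linarith+
      then have "PP (t n i) \<subseteq> D" "QQ (t n i) \<subseteq> D" by (auto simp: D_def PP_def QQ_def)
      then have "\<omega> \<notin> PP (t n i)" "\<omega> \<notin> QQ (t n i)" using False by auto
      then show "\<delta> n * indicator (PP (t n i)) \<omega> + - \<delta> n * indicator (QQ (t n i)) \<omega> = 0" by simp
    qed
    then show ?thesis using False by simp
  qed
  have "defining_seq s (\<lambda>\<omega>. hfun x0 u v (X \<omega>))"
    unfolding fa_defining_seq_def fa_converges_def
  proof (intro conjI allI impI)
    show "s n \<in> fa_simple R" for n using s by (simp add: fa_simple_iff)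
  next
    fix c :: real assume "0 < c"
    then have "\<forall>\<^sub>F n in sequentially. \<delta> n < c" by (rule order_tendstoD(2)[OF \<delta>_lim])
    \<comment> \<open>By uniform approximation the exceptional set is empty once the mesh is below
      \<open>c\<close>.\<close>
    then have "\<forall>\<^sub>F n in sequentially. fa_outer R \<mu> {\<omega>\<in>\<Omega>. c < \<bar>s n \<omega> - hfun x0 u v (X \<omega>)\<bar>} = 0"
    proof eventually_elim
      case (elim n)
      have "\<not> c < \<bar>s n \<omega> - hfun x0 u v (X \<omega>)\<bar>" if "\<omega> \<in> \<Omega>" for \<omega>
        using approx[OF that, of n] elim by simp
      then have "{\<omega>\<in>\<Omega>. c < \<bar>s n \<omega> - hfun x0 u v (X \<omega>)\<bar>} = {}" by blast
      then show ?case by (simp only: fa_outer_empty)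
    qed
    then show "(\<lambda>n. fa_outer R \<mu> {\<omega>\<in>\<Omega>. c < \<bar>s n \<omega> - hfun x0 u v (X \<omega>)\<bar>}) \<longlonglongrightarrow> 0"
      by (rule tendsto_eventually)
  next
    fix e :: real assume "0 < e"
    then have "0 < e / (\<mu> D + 1) / 2" using nonneg[OF D] by simp
    from order_tendstoD(2)[OF \<delta>_lim this]
    obtain n0 where n0: "\<And>n. n0 \<le> n \<Longrightarrow> \<delta> n < e / (\<mu> D + 1) / 2"
      by (auto simp: eventually_sequentially)
    have "int_s (\<lambda>\<omega>. \<bar>s n \<omega> - s m \<omega>\<bar>) < e" if "n0 \<le> n" "n0 \<le> m" for n m
    proof -
      have "int_s (\<lambda>\<omega>. \<bar>s n \<omega> - s m \<omega>\<bar>) \<le> int_s (\<lambda>\<omega>. (\<delta> n + \<delta> m) * indicator D \<omega>)"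
        by (intro int_s_mono simple_map_abs_diff s simple_map_indicator D diff)
      also have "\<dots> = (\<delta> n + \<delta> m) * \<mu> D" by (rule int_s_indicator[OF D])
      also have "\<dots> \<le> (\<delta> n + \<delta> m) * (\<mu> D + 1)"
        using \<delta>_pos[of n] \<delta>_pos[of m] by (intro mult_left_mono) auto
      also have "\<dots> < e / (\<mu> D + 1) * (\<mu> D + 1)"
      proof (rule mult_strict_right_mono)
        show "\<delta> n + \<delta> m < e / (\<mu> D + 1)"
          using add_strict_mono[OF n0[OF that(1)] n0[OF that(2)]] unfolding field_sum_of_halves .
      qed (use nonneg[OF D] in simp)
      also have "\<dots> = e" using nonneg[OF D] by simp
      finally show ?thesis .
    qed
    then show "\<exists>n0. \<forall>n\<ge>n0. \<forall>k\<ge>n0. int_s (\<lambda>\<omega>. \<bar>s n \<omega> - s k \<omega>\<bar>) < e" by blast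
  qed
  moreover have "(\<lambda>n. \<phi> v - \<phi> u - int_s (s n)) \<longlonglongrightarrow> 0"
  proof (rule Lim_null_comparison)
    \<comment> \<open>The estimate used for the kinks applies again with the same tags, now to
      \<open>\<phi>\<close> and \<open>g\<close>.\<close>
    have "\<bar>\<phi> v - \<phi> u - int_s (s n)\<bar> \<le> \<delta> n * (g v - g u)" for n
      unfolding int_s \<delta>_def using \<open>u < v\<close> tag lower upper
      by (intro tagged_sum_error) auto
    then show "\<forall>\<^sub>F n in sequentially. norm (\<phi> v - \<phi> u - int_s (s n)) \<le> \<delta> n * (g v - g u)"
      by simp
    show "(\<lambda>n. \<delta> n * (g v - g u)) \<longlonglongrightarrow> 0"
      using tendsto_mult_right[OF \<delta>_lim, of "g v - g u"] by simp
  qed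
  then have "(\<lambda>n. int_s (s n)) \<longlonglongrightarrow> \<phi> v - \<phi> u"
    using tendsto_diff[OF tendsto_const[of "\<phi> v - \<phi> u"]] by fastforce
  ultimately show ?thesis by (auto simp: has_fa_integral_def)
qed

sublocale fa_representation \<Omega> R \<mu> \<phi> x0 X
proof unfold_locales
  fix u v :: real
  show "(\<lambda>\<omega>. hfun x0 u v (X \<omega>)) \<in> fa_L1 \<Omega> R \<mu>"
    using has_fa_integralD(1)[OF has_fa_integral_hfun_less[of u v]] has_fa_integralD(1)[OF has_fa_integral_zero]
    by (cases "u < v") (simp_all add: hfun_eq_0)
  assume "u \<le> v"
  then show "\<phi> v = \<phi> u + fa_integral \<Omega> R \<mu> (\<lambda>\<omega>. hfun x0 u v (X \<omega>))"
    using has_fa_integralD(2)[OF has_fa_integral_hfun_less[of u v]] has_fa_integralD(2)[OF has_fa_integral_zero]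
    by (cases "u = v") (simp_all add: hfun_eq_0)
qed

end

section \<open>The Stieltjes measure of the derivative\<close>

locale stationary_convex_function = convex_function +
  fixes x0 :: ereal
  assumes right0: "has_right_deriv \<phi> x0 0" and left0: "has_left_deriv \<phi> x0 0"
begin

definition \<nu> :: "real measure" where "\<nu> = interval_measure rd"

definition right_part :: "real \<Rightarrow> real set" where
  "right_part t = {x. x0 < ereal x \<and> x \<le> t}"

definition left_part :: "real \<Rightarrow> real set" where
  "left_part t = {x. ereal x \<le> x0 \<and> t < x}"

lemma sets_\<nu> [simp]: "sets \<nu> = sets borel" by (simp add: \<nu>_def)

lemma space_\<nu> [simp]: "space \<nu> = UNIV" by (simp add: \<nu>_def)

sublocale \<nu>: measure_struct UNIV "fmeasurable \<nu>" "measure \<nu>"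
  using measure_structure_fmeasurable[of \<nu>]
  by (simp add: measure_struct_iff)

lemma emeasure_Ioc: "a \<le> b \<Longrightarrow> emeasure \<nu> {a<..b} = ennreal (rd b - rd a)"
  unfolding \<nu>_def
  by (rule emeasure_interval_measure_Ioc) (auto simp: rd_mono continuous_within rd_right_limit)

text \<open>The point lies in \<open>{w<..t}\<close> for every \<open>w < t\<close>, and the masses
  of these intervals tend to the jump of \<open>rd\<close>. The upper bound is enough because it is
  applied where the jump is 0.\<close>

lemma emeasure_singleton_le: "emeasure \<nu> {t} \<le> ennreal (rd t - ld t)"
proof (rule tendsto_lowerbound)
  show "((\<lambda>w. ennreal (rd t - rd w)) \<longlongrightarrow> ennreal (rd t - ld t)) (at_left t)"
    by (intro tendsto_ennrealI tendsto_intros rd_left_limit)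
  have "emeasure \<nu> {t} \<le> ennreal (rd t - rd w)" if "w < t" for w
    using emeasure_Ioc[of w t] emeasure_mono[of "{t}" "{w<..t}" \<nu>] that by simp
  then show "\<forall>\<^sub>F w in at_left t. emeasure \<nu> {t} \<le> ennreal (rd t - rd w)"
    by (intro eventually_at_leftI[of "t - 1"]) auto
qed simp

lemma rd_x0: "x0 = ereal r \<Longrightarrow> rd r = 0"
  using right_deriv_unique[of 0 r] right0 by (simp add: has_right_deriv_def)

lemma ld_x0: "x0 = ereal r \<Longrightarrow> ld r = 0"
  using left_deriv_unique[of 0 r] left0 by (simp add: has_left_deriv_def)

text \<open>At a finite \<open>x0\<close> both one-sided derivatives vanish, so \<open>rd\<close>
  does not jump there; at an infinite \<open>x0\<close> the set is empty.\<close>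

lemma x0_null: "{x. ereal x = x0} \<in> null_sets \<nu>"
proof (cases x0)
  case (real r)
  then show ?thesis
    using emeasure_singleton_le[of r] rd_x0[OF real] ld_x0[OF real] by (simp add: null_sets_def)
qed auto

text \<open>\<open>rd\<close> rises to 0 at infinity, so the bounded intervals exhausting the
  half-line have masses tending to \<open>- rd t\<close>, which is finite.\<close>

lemma emeasure_Ioi: assumes "x0 = \<infinity>" shows "emeasure \<nu> {t<..} = ennreal (- rd t)"
proof (rule LIMSEQ_unique)
  have "(rd \<longlongrightarrow> 0) at_top"
    using right0 assms by (intro limit_right_deriv) (simp add: has_right_deriv_def)
  then have "(\<lambda>n. rd (t + real n)) \<longlonglongrightarrow> 0"
    by (rule filterlim_compose) (intro filterlim_tendsto_add_at_top[OF tendsto_const] filterlim_real_sequentially)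
  then have "(\<lambda>n. ennreal (rd (t + real n) - rd t)) \<longlonglongrightarrow> ennreal (0 - rd t)"
    by (intro tendsto_ennrealI tendsto_diff tendsto_const)
  then show "(\<lambda>n. emeasure \<nu> {t<..t + real n}) \<longlonglongrightarrow> ennreal (- rd t)"
    by (simp add: emeasure_Ioc)
  have "x \<in> (\<Union>n. {t<..t + real n})" if "t < x" for x
  proof -
    obtain n where "x - t \<le> real n" using real_arch_simple by blast
    then show ?thesis using that by (intro UN_I[of n]) auto
  qed
  then have "(\<Union>n. {t<..t + real n}) = {t<..}" by auto
  moreover have inc: "incseq (\<lambda>n. {t<..t + real n})" by (rule incseq_SucI) auto
  ultimately show "(\<lambda>n. emeasure \<nu> {t<..t + real n}) \<longlonglongrightarrow> emeasure \<nu> {t<..}"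
    using Lim_emeasure_incseq[of "\<lambda>n. {t<..t + real n}" \<nu>, OF _ inc] by (simp add: image_subset_iff)
qed

lemma emeasure_Iic: assumes "x0 = -\<infinity>" shows "emeasure \<nu> {..t} = ennreal (rd t)"
proof (rule LIMSEQ_unique)
  have "(rd \<longlongrightarrow> 0) at_bot"
    using right0 assms by (intro limit_right_deriv) (simp add: has_right_deriv_def)
  moreover have "filterlim (\<lambda>n. t - real n) at_bot sequentially"
    unfolding filterlim_uminus_at_top
    using filterlim_tendsto_add_at_top[OF tendsto_const filterlim_real_sequentially, of "- t"]
    by (simp add: filterlim_uminus_at_bot)
  ultimately have "(\<lambda>n. rd (t - real n)) \<longlonglongrightarrow> 0"
    by (rule filterlim_compose)
  then have "(\<lambda>n. ennreal (rd t - rd (t - real n))) \<longlonglongrightarrow> ennreal (rd t - 0)"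
    by (intro tendsto_ennrealI tendsto_diff tendsto_const)
  then show "(\<lambda>n. emeasure \<nu> {t - real n<..t}) \<longlonglongrightarrow> ennreal (rd t)"
    by (simp add: emeasure_Ioc)
  have "x \<in> (\<Union>n. {t - real n<..t})" if "x \<le> t" for x
  proof -
    obtain n where "t - x < real n" using reals_Archimedean2 by blast
    then show ?thesis using that by (intro UN_I[of n]) auto
  qed
  then have "(\<Union>n. {t - real n<..t}) = {..t}" by auto
  moreover have inc: "incseq (\<lambda>n. {t - real n<..t})" by (rule incseq_SucI) auto
  ultimately show "(\<lambda>n. emeasure \<nu> {t - real n<..t}) \<longlonglongrightarrow> emeasure \<nu> {..t}"
    using Lim_emeasure_incseq[of "\<lambda>n. {t - real n<..t}" \<nu>, OF _ inc] by (simp add: image_subset_iff)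
qed

lemma fmeasurable_\<nu>I:
  assumes "emeasure \<nu> A = ennreal c" "A \<in> sets borel" "0 \<le> c"
  shows "A \<in> fmeasurable \<nu> \<and> measure \<nu> A = c"
  using assms by (simp add: fmeasurable_def measure_eq_emeasure_eq_ennreal)

text \<open>\<open>rd t\<close> is the increase of \<open>rd\<close> from its value or limit 0 at
  \<open>x0\<close>, that is, the signed mass between \<open>x0\<close> and \<open>t\<close>. This
  normalisation makes the parts finite even when they are half-lines.\<close>

lemma parts_fmeasurable: "right_part t \<in> fmeasurable \<nu>" "left_part t \<in> fmeasurable \<nu>"
  and measure_parts: "measure \<nu> (right_part t) - measure \<nu> (left_part t) = rd t"
proof -
  have "right_part t \<in> fmeasurable \<nu> \<and> left_part t \<in> fmeasurable \<nu> \<and>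
    measure \<nu> (right_part t) - measure \<nu> (left_part t) = rd t"
  proof (cases x0)
    case (real r)
    have parts: "right_part t = {r<..t}" "left_part t = {t<..r}"
      unfolding right_part_def left_part_def by (auto simp: real)
    show ?thesis
    proof (cases "r \<le> t")
      case True
      then show ?thesis
        using fmeasurable_\<nu>I[of "{r<..t}" "rd t"] emeasure_Ioc[of r t] rd_mono[of r t] rd_x0[OF real]
        unfolding parts by simp
    next
      case False
      then show ?thesis
        using fmeasurable_\<nu>I[of "{t<..r}" "- rd t"] emeasure_Ioc[of t r] rd_mono[of t r] rd_x0[OF real]
        unfolding parts by simp
    qed
  next
    case PInf
    have parts: "right_part t = {}" "left_part t = {t<..}"
      unfolding right_part_def left_part_def by (auto simp: PInf)
    have "rd t \<le> 0"
    proof (rule tendsto_lowerbound)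
      show "(rd \<longlongrightarrow> 0) at_top"
        using right0 PInf by (intro limit_right_deriv) (simp add: has_right_deriv_def)
      show "\<forall>\<^sub>F x in at_top. rd t \<le> rd x"
        using eventually_ge_at_top[of t] by eventually_elim (rule rd_mono)
    qed simp
    then show ?thesis
      using fmeasurable_\<nu>I[OF emeasure_Ioi[OF PInf]] unfolding parts by simp
  next
    case MInf
    have parts: "right_part t = {..t}" "left_part t = {}"
      unfolding right_part_def left_part_def by (auto simp: MInf)
    have "0 \<le> rd t"
    proof (rule tendsto_upperbound)
      show "(rd \<longlongrightarrow> 0) at_bot"
        using right0 MInf by (intro limit_right_deriv) (simp add: has_right_deriv_def)
      show "\<forall>\<^sub>F x in at_bot. rd x \<le> rd t"
        using eventually_le_at_bot[of t] by eventually_elim (rule rd_mono)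
    qed simp
    then show ?thesis
      using fmeasurable_\<nu>I[OF emeasure_Iic[OF MInf]] unfolding parts by simp
  qed
  then show "right_part t \<in> fmeasurable \<nu>" "left_part t \<in> fmeasurable \<nu>"
    "measure \<nu> (right_part t) - measure \<nu> (left_part t) = rd t"
    by auto
qed

text \<open>On the line every \<open>t\<close> is an admissible tag, since both parts are Borel sets
  of finite mass; the instance yields the representation in (iii).\<close>

sublocale \<nu>: fa_density UNIV "fmeasurable \<nu>" "measure \<nu>" \<phi> rd UNIV x0 "\<lambda>x. x"
proof unfold_locales
  show "\<exists>t\<in>UNIV. a < t \<and> t < b" if "a < b" for a b :: real
    using dense[OF that] by blast
qed (use parts_fmeasurable measure_parts rd_bounds in
  \<open>simp_all add: right_part_def left_part_def\<close>)

text \<open>On an interval inside \<open>A\<close> the gap condition forces \<open>rd\<close> to be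
  constant. Countably many half-open rational intervals, whose closures lie in \<open>A\<close>,
  cover \<open>A\<close>.\<close>

lemma open_null:
  assumes "open A"
    and gap: "\<And>u v. {u<..<v} \<subseteq> A \<Longrightarrow> ld v \<le> rd u"
  shows "A \<in> null_sets \<nu>"
proof -
  define I where "I = {(p, q). p \<in> \<rat> \<and> q \<in> \<rat> \<and> p \<le> q \<and> {p..q} \<subseteq> A}"
  have cover: "A = (\<Union>(p, q)\<in>I. {p<..q})"
  proof
    show "A \<subseteq> (\<Union>(p, q)\<in>I. {p<..q})"
    proof
      fix x assume "x \<in> A"
      then obtain e where e: "0 < e" "\<And>y. \<bar>y - x\<bar> < e \<Longrightarrow> y \<in> A"
        using \<open>open A\<close> by (auto simp: open_real)
      obtain p q where "p \<in> \<rat>" "x - e < p" "p < x" "q \<in> \<rat>" "x < q" "q < x + e"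
        using Rats_dense_in_real[of "x - e" x] Rats_dense_in_real[of x "x + e"] e(1) by auto
      then have "(p, q) \<in> I" "x \<in> {p<..q}"
        using e(2) by (auto simp: I_def)
      then show "x \<in> (\<Union>(p, q)\<in>I. {p<..q})" by blast
    qed
  qed (auto simp: I_def)
  have "(\<Union>i\<in>I. case i of (p, q) \<Rightarrow> {p<..q}) \<in> null_sets \<nu>"
  proof (rule null_sets_UN')
    show "countable I"
      by (rule countable_subset[of _ "\<rat> \<times> \<rat>"]) (auto simp: I_def countable_rat)
    fix i assume "i \<in> I"
    then obtain p q where i: "i = (p, q)" "p \<le> q" "{p..q} \<subseteq> A" by (auto simp: I_def)
    then have "q \<in> A" by auto
    then obtain e where e: "0 < e" "\<And>y. \<bar>y - q\<bar> < e \<Longrightarrow> y \<in> A"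
      using \<open>open A\<close> by (auto simp: open_real)
    have "y \<in> A" if "p < y" "y < q + e" for y
      using that i(3) e(2)[of y] by (cases "y \<le> q") auto
    \<comment> \<open>The gap condition controls only the left derivative at the right end, so the
      interval is extended beyond \<open>q\<close>, where \<open>ld (q + e)\<close> dominates
      \<open>rd q\<close>.\<close>
    then have "ld (q + e) \<le> rd p" by (intro gap) auto
    then have "rd q \<le> rd p" using rd_le_ld[of q "q + e"] e(1) by simp
    then show "(case i of (p, q) \<Rightarrow> {p<..q}) \<in> null_sets \<nu>"
      using i emeasure_Ioc[of p q] by (simp add: null_sets_def ennreal_neg)
  qed
  then show ?thesis using cover by simp
qed

end


section \<open>Pulling a measure back along a map\<close>

text \<open>
  The image of \<open>X\<close> may miss sets of positive measure, so \<open>\<nu>\<close> cannot be pulled back on all Borel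
  sets. It can on the sets with null boundary: if \<open>X -` B\<close> lies in \<open>N\<close>, then so does the preimage of
  the interior of \<open>B\<close>, which is therefore null, and hence so is \<open>B\<close>.
\<close>

locale null_pullback =
  fixes \<nu> :: "'b::topological_space measure" and \<Omega> :: "'a set" and N :: "'a set set" and X :: "'a \<Rightarrow> 'b"
  assumes sets_borel: "sets \<nu> = sets borel"
    and ideal: "set_ideal \<Omega> N"
    and null: "\<And>A. open A \<Longrightarrow> {\<omega>\<in>\<Omega>. X \<omega> \<in> A} \<in> N \<Longrightarrow> A \<in> null_sets \<nu>"
begin

text \<open>The continuity sets of \<open>\<nu>\<close> with finite mass. They form a ring because
  the frontier of a union or difference lies in the union of the two frontiers.\<close>

definition jordan :: "'b set set" where
  "jordan = {B\<in>fmeasurable \<nu>. frontier B \<in> null_sets \<nu>}"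

definition pull :: "'b set \<Rightarrow> 'a set" where "pull B = {\<omega>\<in>\<Omega>. X \<omega> \<in> B}"

text \<open>Members of \<open>N\<close> need not be preimages under \<open>X\<close>; admitting
  errors from \<open>N\<close> brings them into the ring as sets close to the empty set, with
  measure 0.\<close>

definition close_to :: "'a set \<Rightarrow> 'b set \<Rightarrow> bool" where
  "close_to E B \<longleftrightarrow> B \<in> jordan \<and> sym_diff E (pull B) \<in> N"

definition R :: "'a set set" where "R = {E. E \<subseteq> \<Omega> \<and> (\<exists>B. close_to E B)}"

definition \<mu> :: "'a set \<Rightarrow> real" where "\<mu> E = measure \<nu> (SOME B. close_to E B)"

sublocale \<nu>: measure_struct "space \<nu>" "fmeasurable \<nu>" "measure \<nu>"
  using measure_structure_fmeasurable[of \<nu>]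
  by (simp add: measure_struct_iff)

lemma N_subset: "A \<in> N \<Longrightarrow> B \<subseteq> A \<Longrightarrow> B \<in> N"
  and N_Un: "A \<in> N \<Longrightarrow> B \<in> N \<Longrightarrow> A \<union> B \<in> N"
  and N_Pow: "A \<in> N \<Longrightarrow> A \<subseteq> \<Omega>"
  using ideal by (auto simp: set_ideal_def)

lemma N_empty: "{} \<in> N"
  using ideal N_subset[OF _ empty_subsetI] by (auto simp: set_ideal_def)

lemma N_subset_Un: "A \<in> N \<Longrightarrow> B \<in> N \<Longrightarrow> E \<subseteq> A \<union> B \<Longrightarrow> E \<in> N"
  using N_subset N_Un by blast

lemma frontier_null:
  assumes "A \<in> jordan" "B \<in> jordan" "frontier E \<subseteq> frontier A \<union> frontier B"
  shows "frontier E \<in> null_sets \<nu>"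
proof (rule null_sets_subset)
  show "frontier A \<union> frontier B \<in> null_sets \<nu>"
    using assms(1,2) by (auto simp: jordan_def)
qed (use assms(3) sets_borel in auto)

lemma jordan_empty: "{} \<in> jordan"
  by (simp add: jordan_def)

lemma jordan_Un: "A \<in> jordan \<Longrightarrow> B \<in> jordan \<Longrightarrow> A \<union> B \<in> jordan"
  using frontier_null[of A B "A \<union> B", OF _ _ frontier_Un_subset] by (auto simp: jordan_def)

lemma jordan_Diff: "A \<in> jordan \<Longrightarrow> B \<in> jordan \<Longrightarrow> A - B \<in> jordan"
  using frontier_null[of A B "A - B"] frontier_Int_subset[of A "- B"]
  by (auto simp: jordan_def Diff_eq[symmetric] frontier_complement)

lemma jordan_null:
  assumes "B \<in> jordan" "pull B \<in> N" shows "measure \<nu> B = 0"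
proof -
  have "{\<omega>\<in>\<Omega>. X \<omega> \<in> interior B} \<in> N"
    using assms(2) interior_subset[of B] by (auto simp: pull_def intro: N_subset)
  then have null: "interior B \<union> frontier B \<in> null_sets \<nu>"
    using null[OF open_interior] assms(1) by (auto simp: jordan_def)
  have "B \<in> null_sets \<nu>"
  proof (rule null_sets_subset[OF null])
    show "B \<in> sets \<nu>" using assms(1) by (auto simp: jordan_def)
    show "B \<subseteq> interior B \<union> frontier B" using closure_subset[of B] by (auto simp: frontier_def)
  qed
  then show ?thesis by (auto simp: measure_eq_0_null_sets)
qed

text \<open>A point of the preimage of \<open>B - B'\<close> violates one of the two approximations
  of \<open>E\<close>, so this preimage lies in \<open>N\<close> and \<open>B - B'\<close> is null.
  By symmetry all choices of \<open>B\<close> in the definition of \<open>\<mu>\<close> have the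
  same measure.\<close>

lemma close_to_le:
  assumes "close_to E B" "close_to E B'" shows "measure \<nu> B \<le> measure \<nu> B'"
proof -
  have "pull (B - B') \<in> N"
    by (rule N_subset_Un[of "sym_diff E (pull B)" "sym_diff E (pull B')"])
       (use assms in \<open>auto simp: close_to_def pull_def\<close>)
  then have "measure \<nu> (B - B') = 0"
    using assms by (intro jordan_null jordan_Diff) (auto simp: close_to_def)
  moreover have "B \<in> fmeasurable \<nu>" "B' \<in> fmeasurable \<nu>"
    using assms by (auto simp: close_to_def jordan_def)
  then have "measure \<nu> B \<le> measure \<nu> (B' \<union> (B - B'))"
    "measure \<nu> (B' \<union> (B - B')) \<le> measure \<nu> B' + measure \<nu> (B - B')"
    by (intro \<nu>.mu_mono \<nu>.mu_Un_le fmeasurable.Un fmeasurable.Diff; auto)+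
  ultimately show ?thesis by simp
qed

lemma \<mu>_eq: "close_to E B \<Longrightarrow> \<mu> E = measure \<nu> B"
  unfolding \<mu>_def by (metis someI_ex close_to_le antisym)

lemma close_to_Un:
  assumes "close_to E B" "close_to F C" shows "close_to (E \<union> F) (B \<union> C)"
proof -
  have "sym_diff (E \<union> F) (pull (B \<union> C)) \<subseteq> sym_diff E (pull B) \<union> sym_diff F (pull C)"
    by (auto simp: pull_def)
  then show ?thesis
    using assms jordan_Un N_subset_Un unfolding close_to_def by blast
qed

lemma close_to_Diff:
  assumes "close_to E B" "close_to F C" shows "close_to (E - F) (B - C)"
proof -
  have "sym_diff (E - F) (pull (B - C)) \<subseteq> sym_diff E (pull B) \<union> sym_diff F (pull C)"
    by (auto simp: pull_def)
  then show ?thesis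
    using assms jordan_Diff N_subset_Un unfolding close_to_def by blast
qed

lemma close_to_pull: "B \<in> jordan \<Longrightarrow> close_to (pull B) B"
  by (simp add: close_to_def N_empty)

lemma close_to_N: "A \<in> N \<Longrightarrow> close_to A {}"
  by (simp add: close_to_def jordan_empty pull_def)

lemma pull_R: "B \<in> jordan \<Longrightarrow> pull B \<in> R" and \<mu>_pull: "B \<in> jordan \<Longrightarrow> \<mu> (pull B) = measure \<nu> B"
  using close_to_pull \<mu>_eq by (auto simp: R_def pull_def)

lemma N_R: "N \<subseteq> R" and \<mu>_N: "A \<in> N \<Longrightarrow> \<mu> A = 0"
  using close_to_N \<mu>_eq N_Pow by (fastforce simp: R_def)+

sublocale measure_struct \<Omega> R \<mu>
proof (intro measure_struct.intro measure_struct_axioms.intro ring_of_setsI)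
  show "R \<subseteq> Pow \<Omega>" by (auto simp: R_def)
  show "{} \<in> R" using N_R N_empty by blast
  show "E \<union> F \<in> R" "E - F \<in> R" if "E \<in> R" "F \<in> R" for E F
    using that close_to_Un close_to_Diff unfolding R_def by blast+
  show "0 \<le> \<mu> E" for E by (simp add: \<mu>_def)
  show "additive R \<mu>"
    unfolding additive_def
  proof (intro ballI impI)
    fix E F assume "E \<in> R" "F \<in> R" and disj: "E \<inter> F = {}"
    then obtain B C where B: "close_to E B" and C: "close_to F C" by (auto simp: R_def)
    have "F - E = F" using disj by auto
    \<comment> \<open>Disjoint \<open>E\<close> and \<open>F\<close> may have overlapping witnesses;
      removing \<open>B\<close> from \<open>C\<close> leaves a witness for \<open>F - E\<close>,
      which is \<open>F\<close>.\<close>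
    then have D: "close_to F (C - B)" using close_to_Diff[OF C B] by simp
    have "B \<in> fmeasurable \<nu>" "C - B \<in> fmeasurable \<nu>"
      using B D by (auto simp: close_to_def jordan_def)
    then have "measure \<nu> (B \<union> (C - B)) = measure \<nu> B + measure \<nu> (C - B)"
      by (rule \<nu>.mu_Un_disjoint) auto
    then show "\<mu> (E \<union> F) = \<mu> E + \<mu> F"
      using \<mu>_eq[OF B] \<mu>_eq[OF D] \<mu>_eq[OF close_to_Un[OF B D]] by simp
  qed
qed

end

section \<open>Representing a given convex function on \<open>\<Omega>\<close>\<close>

lemma ennreal_tendsto_0I:
  fixes f :: "nat \<Rightarrow> ennreal"
  assumes "\<And>e::real. 0 < e \<Longrightarrow> \<forall>\<^sub>F n in sequentially. f n < ennreal e"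
  shows "f \<longlonglongrightarrow> 0"
proof (rule order_tendstoI)
  fix a :: ennreal assume "0 < a"
  then obtain c where c: "0 < c" "c < a" using dense by blast
  then have "c < top" by (metis less_top_ennreal order_less_trans top.not_eq_extremum)
  then obtain e where "0 < e" "c = ennreal e"
    using c(1) by (cases c) auto
  then show "\<forall>\<^sub>F n in sequentially. f n < a"
    using assms[of e] c(2) by (auto elim!: eventually_mono)
qed simp

context stationary_convex_function
begin

lemma frontier_parts:
  "frontier (right_part t) \<subseteq> {x. ereal x = x0} \<union> {t}" "frontier (left_part t) \<subseteq> {x. ereal x = x0} \<union> {t}"
proof -
  have parts: "right_part t = {x. x0 < ereal x} \<inter> {..t}" "left_part t = - {x. x0 < ereal x} \<inter> {t<..}"
    by (auto simp: right_part_def left_part_def not_less)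
  have half_lines: "frontier {..s} = {s}" "frontier {s<..} = {s}" for s :: real
    by (auto simp: frontier_def interior_open[OF open_greaterThan])
  have "frontier {x. x0 < ereal x} \<subseteq> {x. ereal x = x0}"
  proof (cases x0)
    case (real r)
    then have "{x. x0 < ereal x} = {r<..}" by auto
    then show ?thesis using real half_lines(2)[of r] by simp
  qed auto
  then show "frontier (right_part t) \<subseteq> {x. ereal x = x0} \<union> {t}"
    "frontier (left_part t) \<subseteq> {x. ereal x = x0} \<union> {t}"
    unfolding parts using half_lines[of t] frontier_Int_subset[of "{x. x0 < ereal x}" "{..t}"]
      frontier_Int_subset[of "- {x. x0 < ereal x}" "{t<..}"]
    by (auto simp: frontier_complement)
qed

lemma isCont_singleton_null:
  assumes "isCont rd t" shows "{t} \<in> null_sets \<nu>"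
proof -
  have "(rd \<longlongrightarrow> rd t) (at_left t)"
    using assms by (simp add: isCont_def filterlim_at_split)
  then have "rd t = ld t"
    using rd_left_limit by (rule tendsto_unique[OF trivial_limit_at_left_real])
  then show ?thesis using emeasure_singleton_le[of t] by (simp add: null_sets_def)
qed

text \<open>A monotone function has only countably many discontinuities, and these cannot fill an
  open interval.\<close>

lemma isCont_rd_dense:
  assumes "a < b" shows "\<exists>t\<in>{t. isCont rd t}. a < t \<and> t < b"
proof -
  have "mono rd" by (auto intro: monoI rd_mono)
  from open_minus_countable[OF mono_ctble_discont[OF this], of "{a<..<b}"] assms
  show ?thesis by auto
qed

text \<open>The frontier of a part can contain \<open>t\<close> besides \<open>x0\<close>. Since
  \<open>x0\<close> carries no mass, restricting the tags to continuity points of \<open>rd\<close>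
  makes both parts continuity sets, and such tags are still dense.\<close>

lemma pullback_representation:
  assumes "null_pullback \<nu> \<Omega> N X"
  shows "fa_density \<Omega> (null_pullback.R \<nu> \<Omega> N X) (null_pullback.\<mu> \<nu> \<Omega> N X) \<phi> rd {t. isCont rd t} x0 X"
proof -
  interpret pb: null_pullback \<nu> \<Omega> N X by fact
  have jordan: "right_part t \<in> pb.jordan" "left_part t \<in> pb.jordan" if "isCont rd t" for t
  proof -
    have null: "{x. ereal x = x0} \<union> {t} \<in> null_sets \<nu>"
      using x0_null isCont_singleton_null[OF that] by (rule null_sets.Un)
    show "right_part t \<in> pb.jordan" "left_part t \<in> pb.jordan"
      using parts_fmeasurable null_sets_subset[OF null _ frontier_parts(1)]
        null_sets_subset[OF null _ frontier_parts(2)]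
      by (auto simp: pb.jordan_def)
  qed
  have pull: "{\<omega>\<in>\<Omega>. x0 < ereal (X \<omega>) \<and> X \<omega> \<le> t} = pb.pull (right_part t)"
    "{\<omega>\<in>\<Omega>. ereal (X \<omega>) \<le> x0 \<and> t < X \<omega>} = pb.pull (left_part t)" for t
    by (auto simp: pb.pull_def right_part_def left_part_def)
  show ?thesis
    using isCont_rd_dense rd_bounds
    by unfold_locales (auto simp: pull pb.pull_R pb.\<mu>_pull jordan measure_parts)
qed

text \<open>Near a finite \<open>x0\<close> the set is covered by two members of the ring with
  masses \<open>- rd a\<close> and \<open>rd b\<close>, where \<open>a < x0 < b\<close>. Both are
  small because the one-sided limits of \<open>rd\<close> at \<open>x0\<close> are 0. For infinite
  \<open>x0\<close> the set is empty.\<close>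

lemma fa_outer_near_x0:
  assumes "fa_density \<Omega> R \<mu> \<phi> rd C x0 X"
  shows "(\<lambda>n::nat. fa_outer R \<mu> {\<omega>\<in>\<Omega>. \<bar>ereal (X \<omega>) - x0\<bar> < ereal (1 / 2 ^ n)}) \<longlonglongrightarrow> 0"
proof -
  interpret d: fa_density \<Omega> R \<mu> \<phi> rd C x0 X by fact
  show ?thesis
  proof (cases x0)
    case (real r)
    show ?thesis
    proof (rule ennreal_tendsto_0I)
      fix e :: real assume "0 < e"
      have "\<forall>\<^sub>F t in at_right r. rd t < e / 2"
        using \<open>0 < e\<close> rd_x0[OF real] by (intro order_tendstoD(2)[OF rd_right_limit]) simp
      then obtain b' where b': "r < b'" "\<And>t. r < t \<Longrightarrow> t < b' \<Longrightarrow> rd t < e / 2"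
        unfolding eventually_at_right[of r "r + 1", simplified] by auto
      have "\<forall>\<^sub>F t in at_left r. - (e / 2) < rd t"
        using \<open>0 < e\<close> ld_x0[OF real] by (intro order_tendstoD(1)[OF rd_left_limit]) simp
      then obtain a' where a': "a' < r" "\<And>t. a' < t \<Longrightarrow> t < r \<Longrightarrow> - (e / 2) < rd t"
        unfolding eventually_at_left[of "r - 1" r, simplified] by auto
      obtain a b where a: "a \<in> C" "a' < a" "a < r" and b: "b \<in> C" "r < b" "b < b'"
        using d.dense[OF a'(1)] d.dense[OF b'(1)] by blast
      define A where "A = {\<omega>\<in>\<Omega>. ereal (X \<omega>) \<le> x0 \<and> a < X \<omega>}"
      define B where "B = {\<omega>\<in>\<Omega>. x0 < ereal (X \<omega>) \<and> X \<omega> \<le> b}"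
      have AB: "A \<in> R" "B \<in> R" using d.P d.Q a b by (auto simp: A_def B_def)
      \<comment> \<open>On each side of \<open>x0\<close> one of the two sets in the density formula
        is empty, so the masses of \<open>A\<close> and \<open>B\<close> can be read off from
        \<open>rd\<close> at the tags.\<close>
      have empty: "{\<omega>\<in>\<Omega>. x0 < ereal (X \<omega>) \<and> X \<omega> \<le> a} = {}" "{\<omega>\<in>\<Omega>. ereal (X \<omega>) \<le> x0 \<and> b < X \<omega>} = {}"
        using a b by (auto simp: real)
      have "\<mu> B = rd b" "- \<mu> A = rd a"
        using d.\<mu>[OF a(1)] d.\<mu>[OF b(1)] unfolding empty A_def B_def by (simp_all add: d.mu_empty)
      then have "\<mu> (A \<union> B) < e"
        using d.mu_Un_le[OF AB] a'(2)[OF a(2,3)] b'(2)[OF b(2,3)] by simp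
      have "(\<lambda>n. (1 / 2) ^ n :: real) \<longlonglongrightarrow> 0" by (rule LIMSEQ_power_zero) simp
      then have "\<forall>\<^sub>F n in sequentially. (1 / 2) ^ n < min (r - a) (b - r)"
        using a b by (intro order_tendstoD(2)) auto
      then show "\<forall>\<^sub>F n in sequentially.
        fa_outer R \<mu> {\<omega>\<in>\<Omega>. \<bar>ereal (X \<omega>) - x0\<bar> < ereal (1 / 2 ^ n)} < ennreal e"
      proof eventually_elim
        case (elim n)
        have "{\<omega>\<in>\<Omega>. \<bar>ereal (X \<omega>) - x0\<bar> < ereal (1 / 2 ^ n)} \<subseteq> A \<union> B"
          using elim by (auto simp: A_def B_def real power_one_over)
        then have "fa_outer R \<mu> {\<omega>\<in>\<Omega>. \<bar>ereal (X \<omega>) - x0\<bar> < ereal (1 / 2 ^ n)} \<le> ennreal (\<mu> (A \<union> B))"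
          using AB by (intro d.fa_outer_le) auto
        also have "\<dots> < ennreal e"
          using \<open>\<mu> (A \<union> B) < e\<close> \<open>0 < e\<close> by (rule ennreal_lessI[rotated])
        finally show ?case .
      qed
    qed
  qed (simp_all add: d.fa_outer_empty)
qed

end

section \<open>Equivalence of the three properties\<close>

lemma fa_representation_gap_derivs:
  assumes "fa_representation \<Omega> R \<mu> \<phi> x0 X"
    and null: "u < v \<Longrightarrow> fa_outer R \<mu> {\<omega>\<in>\<Omega>. u < X \<omega> \<and> X \<omega> < v} = 0"
  shows "\<exists>a b. has_left_deriv \<phi> (ereal v) a \<and> has_right_deriv \<phi> (ereal u) b \<and> a \<le> b"
proof -
  interpret r: fa_representation \<Omega> R \<mu> \<phi> x0 X by fact
  interpret convex_function \<phi> using r.convex by unfold_locales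
  show ?thesis
  proof (cases "u < v")
    case True
    then show ?thesis using r.gap_derivs[OF True null] by blast
  next
    case False
    \<comment> \<open>For \<open>v \<le> u\<close> the gap is empty and gives no information; the
      inequality is monotonicity of the one-sided derivatives.\<close>
    then have "ld v \<le> rd u" using ld_le_rd[of v] rd_mono[of v u] by simp
    then show ?thesis
      using left_deriv[of v] right_deriv[of u] by (auto simp: has_left_deriv_def has_right_deriv_def)
  qed
qed

theorem theorem5:
  fixes \<phi> :: "real \<Rightarrow> real" and x0 :: ereal
    and \<Omega> :: "'a set" and N :: "'a set set" and X :: "'a \<Rightarrow> real"
  assumes "is_arg_inf \<phi> x0"
    and "has_right_deriv \<phi> x0 0" and "has_left_deriv \<phi> x0 0"
    and "set_ideal \<Omega> N"
  shows "let
    i = (convex_on UNIV \<phi> \<and>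
         (\<forall>u v :: real. {\<omega>\<in>\<Omega>. u < X \<omega> \<and> X \<omega> < v} \<in> N \<longrightarrow>
            (\<exists>a b. has_left_deriv \<phi> (ereal v) a \<and> has_right_deriv \<phi> (ereal u) b \<and> a \<le> b)));
    ii = (\<exists>R \<mu>. measure_structure \<Omega> R \<mu> \<and>
         N \<subseteq> R \<and> (\<forall>A\<in>N. \<mu> A = 0) \<and>
         (\<lambda>n::nat. fa_outer R \<mu> {\<omega>\<in>\<Omega>. \<bar>ereal (X \<omega>) - x0\<bar> < ereal (1 / 2 ^ n)}) \<longlonglongrightarrow> 0 \<and>
         (\<forall>u v. (\<lambda>\<omega>. hfun x0 u v (X \<omega>)) \<in> fa_L1 \<Omega> R \<mu>) \<and>
         (\<forall>u v. u \<le> v \<longrightarrow> \<phi> v = \<phi> u + fa_integral \<Omega> R \<mu> (\<lambda>\<omega>. hfun x0 u v (X \<omega>))));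
    iii = (\<exists>\<nu> :: real measure. sets \<nu> = sets borel \<and>
         (\<forall>A. open A \<and> {\<omega>\<in>\<Omega>. X \<omega> \<in> A} \<in> N \<longrightarrow> emeasure \<nu> A = 0) \<and>
         fa_outer (fmeasurable \<nu>) (measure \<nu>) {x. ereal x = x0} = 0 \<and>
         (\<forall>u v. hfun x0 u v \<in> fa_L1 UNIV (fmeasurable \<nu>) (measure \<nu>)) \<and>
         (\<forall>u v. u \<le> v \<longrightarrow>
            \<phi> v = \<phi> u + fa_integral UNIV (fmeasurable \<nu>) (measure \<nu>) (hfun x0 u v)))
    in (i \<longleftrightarrow> ii) \<and> (ii \<longleftrightarrow> iii)"
proof -
  let ?i = "convex_on UNIV \<phi> \<and>
    (\<forall>u v :: real. {\<omega>\<in>\<Omega>. u < X \<omega> \<and> X \<omega> < v} \<in> N \<longrightarrow>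
      (\<exists>a b. has_left_deriv \<phi> (ereal v) a \<and> has_right_deriv \<phi> (ereal u) b \<and> a \<le> b))"
  let ?ii = "\<lambda>R \<mu>. measure_structure \<Omega> R \<mu> \<and> N \<subseteq> R \<and> (\<forall>A\<in>N. \<mu> A = 0) \<and>
    (\<lambda>n::nat. fa_outer R \<mu> {\<omega>\<in>\<Omega>. \<bar>ereal (X \<omega>) - x0\<bar> < ereal (1 / 2 ^ n)}) \<longlonglongrightarrow> 0 \<and>
    (\<forall>u v. (\<lambda>\<omega>. hfun x0 u v (X \<omega>)) \<in> fa_L1 \<Omega> R \<mu>) \<and>
    (\<forall>u v. u \<le> v \<longrightarrow> \<phi> v = \<phi> u + fa_integral \<Omega> R \<mu> (\<lambda>\<omega>. hfun x0 u v (X \<omega>)))"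
  let ?iii = "\<lambda>\<nu> :: real measure. sets \<nu> = sets borel \<and>
    (\<forall>A. open A \<and> {\<omega>\<in>\<Omega>. X \<omega> \<in> A} \<in> N \<longrightarrow> emeasure \<nu> A = 0) \<and>
    fa_outer (fmeasurable \<nu>) (measure \<nu>) {x. ereal x = x0} = 0 \<and>
    (\<forall>u v. hfun x0 u v \<in> fa_L1 UNIV (fmeasurable \<nu>) (measure \<nu>)) \<and>
    (\<forall>u v. u \<le> v \<longrightarrow> \<phi> v = \<phi> u + fa_integral UNIV (fmeasurable \<nu>) (measure \<nu>) (hfun x0 u v))"
  have ii_i: ?i if ii: "?ii R \<mu>" for R \<mu>
  proof -
    have represents: "fa_representation \<Omega> R \<mu> \<phi> x0 X"
      using ii measure_struct_iff by (auto simp: fa_representation_def fa_representation_axioms_def)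
    then interpret fa_representation \<Omega> R \<mu> \<phi> x0 X .
    have "fa_outer R \<mu> A = 0" if "A \<in> N" for A
      using that ii fa_outer_eq[of A] by auto
    then show ?thesis using convex fa_representation_gap_derivs[OF represents] by blast
  qed

  have iii_i: ?i if iii: "?iii \<nu>" for \<nu>
  proof -
    have "space \<nu> = UNIV" using iii sets_eq_imp_space_eq[of \<nu> borel] by simp
    then have represents: "fa_representation UNIV (fmeasurable \<nu>) (measure \<nu>) \<phi> x0 (\<lambda>x. x)"
      using iii measure_struct_iff[of UNIV "fmeasurable \<nu>"] measure_structure_fmeasurable[of \<nu>]
      by (auto simp: fa_representation_def fa_representation_axioms_def)
    then interpret fa_representation UNIV "fmeasurable \<nu>" "measure \<nu>" \<phi> x0 "\<lambda>x. x" .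
    have null: "fa_outer (fmeasurable \<nu>) (measure \<nu>) {x\<in>UNIV. u < x \<and> x < v} = 0"
      if "{\<omega>\<in>\<Omega>. u < X \<omega> \<and> X \<omega> < v} \<in> N" for u v
    proof -
      \<comment> \<open>The interval is itself an open set whose preimage is in the ideal, so
        condition (a) applies to it.\<close>
      have "emeasure \<nu> {u<..<v} = 0"
        using iii that open_greaterThanLessThan[of u v] by auto
      moreover have "{u<..<v} \<in> sets \<nu>" using iii by simp
      ultimately have "{u<..<v} \<in> fmeasurable \<nu>" "measure \<nu> {u<..<v} = 0"
        by (auto simp: fmeasurable_def measure_def)
      then have "fa_outer (fmeasurable \<nu>) (measure \<nu>) {u<..<v} = 0"
        using fa_outer_eq[of "{u<..<v}"] by simp
      moreover have "{x\<in>UNIV. u < x \<and> x < v} = {u<..<v}" by auto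
      ultimately show ?thesis by (simp only:)
    qed
    show ?thesis using convex fa_representation_gap_derivs[OF represents null] by blast
  qed

  \<comment> \<open>One Stieltjes measure serves both claims: as it stands for (iii), and through
    its continuity sets pulled back along \<open>X\<close> for (ii).\<close>
  have i_ii_iii: "(\<exists>R \<mu>. ?ii R \<mu>) \<and> (\<exists>\<nu>. ?iii \<nu>)" if i: ?i
  proof -
    interpret stationary_convex_function \<phi> x0
      using i assms(2,3) by unfold_locales auto
    have null: "A \<in> null_sets \<nu>" if "open A" and A: "{\<omega>\<in>\<Omega>. X \<omega> \<in> A} \<in> N" for A
    proof (rule open_null[OF \<open>open A\<close>])
      fix u v assume "{u<..<v} \<subseteq> A"
      \<comment> \<open>Closure of the ideal under subsets passes from \<open>A\<close> to every
        interval inside it, which supplies the derivative inequality of (i) on each of them.\<close>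
      then have "{\<omega>\<in>\<Omega>. u < X \<omega> \<and> X \<omega> < v} \<subseteq> {\<omega>\<in>\<Omega>. X \<omega> \<in> A}" by auto
      then have "{\<omega>\<in>\<Omega>. u < X \<omega> \<and> X \<omega> < v} \<in> N"
        using A assms(4) unfolding set_ideal_def by blast
      then obtain a b where "has_left_deriv \<phi> (ereal v) a" "has_right_deriv \<phi> (ereal u) b" "a \<le> b"
        using i by blast
      then show "ld v \<le> rd u"
        using left_deriv_unique[of a v] right_deriv_unique[of b u]
        by (simp add: has_left_deriv_def has_right_deriv_def)
    qed
    then interpret pb: null_pullback \<nu> \<Omega> N X
      using assms(4) by unfold_locales auto
    interpret d: fa_density \<Omega> pb.R pb.\<mu> \<phi> rd "{t. isCont rd t}" x0 X
      using pullback_representation[OF pb.null_pullback_axioms] .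
    have ii: "?ii pb.R pb.\<mu>"
      using measure_struct_iff[of \<Omega> pb.R pb.\<mu>] pb.measure_struct_axioms pb.N_R pb.\<mu>_N
        fa_outer_near_x0[OF d.fa_density_axioms] d.L1 d.rep by blast
    have iii: "?iii \<nu>"
    proof (intro conjI allI impI)
      show "emeasure \<nu> A = 0" if "open A \<and> {\<omega>\<in>\<Omega>. X \<omega> \<in> A} \<in> N" for A
        using null that by (blast intro: null_setsD1)
      show "fa_outer (fmeasurable \<nu>) (measure \<nu>) {x. ereal x = x0} = 0"
      proof -
        have "{x. ereal x = x0} \<in> fmeasurable \<nu>"
          using x0_null by (auto simp: fmeasurable_def null_sets_def)
        from \<nu>.fa_outer_eq[OF this] show ?thesis
          by (simp add: measure_eq_0_null_sets[OF x0_null])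
      qed
    qed (rule sets_\<nu> \<nu>.L1 \<nu>.rep, assumption?)+
    show ?thesis
    proof (rule conjI)
      show "\<exists>R \<mu>. ?ii R \<mu>" by (rule exI[of _ pb.R], rule exI[of _ pb.\<mu>], rule ii)
      show "\<exists>\<nu>. ?iii \<nu>" by (rule exI[of _ \<nu>], rule iii)
    qed
  qed

  have "?i \<longleftrightarrow> (\<exists>R \<mu>. ?ii R \<mu>)"
    by (rule iffI, erule i_ii_iii[THEN conjunct1], elim exE, rule ii_i)
  moreover have "?i \<longleftrightarrow> (\<exists>\<nu>. ?iii \<nu>)"
    by (rule iffI, erule i_ii_iii[THEN conjunct2], elim exE, rule iii_i)
  ultimately show ?thesis
    unfolding Let_def by argo
qed

end
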